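(* Let $p,d\ge1$, let $\varepsilon,\varepsilon_n$ ($n\in\mathbf{Z}$) be i.i.d., and consider the recursion for $X_n\in\mathbf{R}^d$ $$X_{n+1}=R(X_n,\ldots,X_{n-p+1};\varepsilon_{n+1}),\qquad( * )$$ where $R$ is a measurable function. Let $\alpha>0$ and $\alpha'=\min(1,\alpha)$. Assume that $R(y_0;\varepsilon)\in\mathcal{L}^\alpha$ for some $y_0\in(\mathbf{R}^d)^p$ and that there exist constants $a_1,\ldots,a_p\ge0$ such that $\sum_{j=1}^pa_j<1$ and $$\|R(y;\varepsilon)-R(y';\varepsilon)\|_\alpha^{\alpha'}\le\sum_{j=1}^pa_j|x_j-x_j'|^{\alpha'}\qquad( ** )$$ holds for all $y=(x_1,\ldots,x_p)$ and $y'=(x_1',\ldots,x_p')$ in $(\mathbf{R}^d)^p$. Then (i) $( * )$ admits a stationary solution of the form $X_n=G(\ldots,\varepsilon_{n-1},\varepsilon_n)$ with $G$ measurable, and (ii) $X_n$ satisfies GMC($\alpha$). In particular, if there exist functions $H_j$ such that $|R(y;\varepsilon)-R(y';\varepsilon)|\le\sum_{j=1}^pH_j(\varepsilon)|x_j-x_j'|$ for all $y$ and $y'$ and $\sum_{j=1}^p\|H_j(\varepsilon)\|_\alpha^{\alpha'}<1$, then one can take $a_j=\|H_j(\varepsilon)\|_\alpha^{\alpha'}$ in $( ** )$.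
   Context: $|\cdot|$ is the Euclidean norm; $\|\xi\|_\alpha=[\mathbf{E}(|\xi|^\alpha)]^{1/\alpha}$ and $\xi\in\mathcal{L}^\alpha$ means $\|\xi\|_\alpha<\infty$, for any $\alpha>0$. GMC($\alpha$) (geometric-moment contraction) for $X_n=G(\ldots,\varepsilon_{n-1},\varepsilon_n)$: with $(\varepsilon'_k)_{k\in\mathbf{Z}}$ an i.i.d. copy of $(\varepsilon_k)_{k\in\mathbf{Z}}$ (independent of it) and $X_n'=G(\ldots,\varepsilon'_{-1},\varepsilon'_0,\varepsilon_1,\ldots,\varepsilon_n)$, there exist $C>0$ and $0<\rho<1$ such that $\mathbf{E}(|X_n'-X_n|^\alpha)\le C\rho^n$ for all $n\in\mathbf{N}$. *)

theory Defs
  imports "HOL-Probability.Probability"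
begin

definition iid :: "'w measure \<Rightarrow> 'e measure \<Rightarrow> ('i \<Rightarrow> 'w \<Rightarrow> 'e) \<Rightarrow> 'i set \<Rightarrow> bool" where
  "iid M S X I \<longleftrightarrow> prob_space.indep_vars M (\<lambda>_. S) X I \<and>
     (\<forall>i\<in>I. \<forall>j\<in>I. distr M S (X i) = distr M S (X j))"

text \<open>
  Powers and \<open>L\<^sup>\<alpha>\<close> norms are taken in \<open>[0, \<infinity>]\<close>, so that \<open>\<parallel>\<xi>\<parallel>\<^sub>\<alpha> < \<infinity>\<close> expresses
  membership in \<open>L\<^sup>\<alpha>\<close> and a finite upper bound on a norm carries integrability with it.
  They are used for positive exponents only.
\<close>

definition epowr :: "ennreal \<Rightarrow> real \<Rightarrow> ennreal" where
  "epowr x a = (if x = \<infinity> then \<infinity> else ennreal (enn2real x powr a))"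

definition Lnorm :: "'w measure \<Rightarrow> real \<Rightarrow> ('w \<Rightarrow> 'b::real_normed_vector) \<Rightarrow> ennreal" where
  "Lnorm M \<alpha> \<xi> = epowr (\<integral>\<^sup>+\<omega>. ennreal (norm (\<xi> \<omega>) powr \<alpha>) \<partial>M) (1 / \<alpha>)"

definition in_L :: "'w measure \<Rightarrow> real \<Rightarrow> ('w \<Rightarrow> 'b::real_normed_vector) \<Rightarrow> bool" where
  "in_L M \<alpha> \<xi> \<longleftrightarrow> \<xi> \<in> borel_measurable M \<and> Lnorm M \<alpha> \<xi> < \<infinity>"

text \<open>
  A state \<open>(x\<^sub>1, \<dots>, x\<^sub>p)\<close> in the \<open>p\<close>-fold power of \<open>\<real>\<^sup>d\<close> is a function in
  \<open>{1..p} \<rightarrow>\<^sub>E UNIV\<close>, the space of the product Borel measure on \<open>{1..p}\<close>.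
\<close>

definition states :: "nat \<Rightarrow> (nat \<Rightarrow> 'b::topological_space) measure" where
  "states p = (\<Pi>\<^sub>M j\<in>{1..p}. borel)"

text \<open>The state \<open>(X\<^sub>n, \<dots>, X\<^bsub>n-p+1\<^esub>)\<close>: its \<open>j\<close>-th entry is \<open>X\<^bsub>n-j+1\<^esub>\<close>.\<close>

definition lags :: "nat \<Rightarrow> (int \<Rightarrow> 'b) \<Rightarrow> int \<Rightarrow> nat \<Rightarrow> 'b" where
  "lags p x n = (\<lambda>j\<in>{1..p}. x (n - int j + 1))"

definition solves_recursion ::
  "'w measure \<Rightarrow> nat \<Rightarrow> ((nat \<Rightarrow> 'b) \<Rightarrow> 'e \<Rightarrow> 'b) \<Rightarrow> (int \<Rightarrow> 'w \<Rightarrow> 'e) \<Rightarrow> (int \<Rightarrow> 'w \<Rightarrow> 'b) \<Rightarrow> bool" where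
  "solves_recursion M p R \<epsilon> X \<longleftrightarrow>
     (AE \<omega> in M. \<forall>n. X (n + 1) \<omega> = R (lags p (\<lambda>i. X i \<omega>) n) (\<epsilon> (n + 1) \<omega>))"

text \<open>Strict stationarity: the law on path space is invariant under time shifts.\<close>

definition stationary :: "'w measure \<Rightarrow> (int \<Rightarrow> 'w \<Rightarrow> 'b::topological_space) \<Rightarrow> bool" where
  "stationary M X \<longleftrightarrow> (\<forall>n. X n \<in> borel_measurable M) \<and>
     (\<forall>k. distr M (\<Pi>\<^sub>M n\<in>UNIV. borel) (\<lambda>\<omega> n. X (n + k) \<omega>) =
          distr M (\<Pi>\<^sub>M n\<in>UNIV. borel) (\<lambda>\<omega> n. X n \<omega>))"

text \<open>
  The one-sided past \<open>(\<dots>, e\<^bsub>n-1\<^esub>, e\<^sub>n)\<close> is stored backwards in time: entry \<open>k\<close> is \<open>e\<^bsub>n-k\<^esub>\<close>.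
\<close>

definition past :: "(int \<Rightarrow> 'e) \<Rightarrow> int \<Rightarrow> nat \<Rightarrow> 'e" where
  "past e n = (\<lambda>k. e (n - int k))"

definition causal :: "((nat \<Rightarrow> 'e) \<Rightarrow> 'b) \<Rightarrow> (int \<Rightarrow> 'w \<Rightarrow> 'e) \<Rightarrow> int \<Rightarrow> 'w \<Rightarrow> 'b" where
  "causal G \<epsilon> n \<omega> = G (past (\<lambda>i. \<epsilon> i \<omega>) n)"

text \<open>
  Geometric-moment contraction. On \<open>M \<Otimes>\<^sub>M M\<close> the first coordinate carries the sequence
  \<open>\<epsilon>\<close> and the second one an i.i.d. copy of it that is independent of it; the statement
  depends only on the joint law of the two sequences, so no generality is lost by this
  choice, and \<open>M\<close> itself need not be rich enough to carry a copy.
\<close>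

definition GMC ::
  "'w measure \<Rightarrow> ((nat \<Rightarrow> 'e) \<Rightarrow> 'b::real_normed_vector) \<Rightarrow> (int \<Rightarrow> 'w \<Rightarrow> 'e) \<Rightarrow> real \<Rightarrow> bool" where
  "GMC M G \<epsilon> \<alpha> \<longleftrightarrow>
     (let X = (\<lambda>n (\<omega>, \<omega>'). causal G \<epsilon> n \<omega>);
          X' = (\<lambda>n (\<omega>, \<omega>'). G (past (\<lambda>i. if i \<le> 0 then \<epsilon> i \<omega>' else \<epsilon> i \<omega>) n))
      in \<exists>C \<rho>. 0 < C \<and> 0 < \<rho> \<and> \<rho> < 1 \<and>
           (\<forall>n::nat. (\<integral>\<^sup>+ w. ennreal (norm (X' (int n) w - X (int n) w) powr \<alpha>) \<partial>(M \<Otimes>\<^sub>M M))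
                      \<le> ennreal (C * \<rho> ^ n)))"

text \<open>
  The contraction inequality for an innovation \<open>\<eta>\<close> with coefficients \<open>a\<close>, where
  \<open>\<alpha>' = min 1 \<alpha>\<close>.
\<close>

definition contraction ::
  "'w measure \<Rightarrow> nat \<Rightarrow> ((nat \<Rightarrow> 'b::real_normed_vector) \<Rightarrow> 'e \<Rightarrow> 'b) \<Rightarrow> ('w \<Rightarrow> 'e) \<Rightarrow> real \<Rightarrow> (nat \<Rightarrow> real) \<Rightarrow> bool" where
  "contraction M p R \<eta> \<alpha> a \<longleftrightarrow>
     (\<forall>y\<in>space (states p). \<forall>y'\<in>space (states p).
        epowr (Lnorm M \<alpha> (\<lambda>\<omega>. R y (\<eta> \<omega>) - R y' (\<eta> \<omega>))) (min 1 \<alpha>)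
          \<le> ennreal (\<Sum>j=1..p. a j * norm (y j - y' j) powr min 1 \<alpha>))"

end

theory Submission
  imports Defs
begin

text \<open>
  Put \<open>\<beta> = max 1 \<alpha>\<close> and \<open>q x = norm x powr min 1 \<alpha>\<close>. Then \<open>q\<close> is subadditive and the left-hand side of the
  contraction inequality is the \<open>L\<^sup>\<beta>\<close> norm of \<open>q (R y \<epsilon> - R y' \<epsilon>)\<close>, so that Minkowski's inequality
  treats \<open>\<alpha> \<le> 1\<close> and \<open>\<alpha> \<ge> 1\<close> at once. Iterate the recursion backwards: let \<open>Z\<^sub>m\<close> be the state
  reached from \<open>y\<^sub>0\<close> by the last \<open>m\<close> innovations. Conditioning on the most recent innovation,
  the increments \<open>Z\<^bsub>m+1\<^esub> - Z\<^sub>m\<close> decay geometrically, hence \<open>Z\<^sub>m\<close> converges almost surely and its first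
  entry defines \<open>G\<close>. The recursion passes to the limit. Contraction of moments holds because
  \<open>X\<^sub>n\<close> and \<open>X\<^sub>n'\<close> share the last \<open>n\<close> innovations, so both are within geometric distance
  of the same \<open>Z\<^sub>n\<close>.
\<close>

text \<open>For \<open>f, K \<ge> 0\<close> and \<open>\<beta> > 0\<close> this bounds the \<open>L\<^sup>\<beta>\<close> norm of \<open>f\<close> by \<open>K\<close>.\<close>

definition moment_bound :: "'a measure \<Rightarrow> real \<Rightarrow> ('a \<Rightarrow> real) \<Rightarrow> real \<Rightarrow> bool" where
  "moment_bound N \<beta> f K \<longleftrightarrow> (\<integral>\<^sup>+x. ennreal (f x powr \<beta>) \<partial>N) \<le> ennreal (K powr \<beta>)"

section \<open>Convexity and Minkowski's inequality for moment bounds\<close>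

text \<open>The point 0 matters because Jensen's inequality is applied to functions that may vanish.
  With 0 as an endpoint, convexity comes down to \<open>s powr \<beta> \<le> s\<close> for 0 < s <
  1.\<close>

lemma convex_on_powr_nonneg:
  assumes "\<beta> \<ge> 1"
  shows "convex_on {0..} (\<lambda>x::real. x powr \<beta>)"
proof (rule convex_onI)
  fix t x y :: real
  assume t: "0 < t" "t < 1" and xy: "x \<in> {0..}" "y \<in> {0..}"
  have scale: "(s * z) powr \<beta> \<le> s * z powr \<beta>" if "0 < s" "s < 1" "0 \<le> z" for s z
  proof -
    have "s powr \<beta> \<le> s powr 1"
      using that assms by (intro powr_mono') auto
    then show ?thesis
      using that by (simp add: powr_mult mult_right_mono)
  qed
  consider "x = 0" | "y = 0" | "x > 0" "y > 0"
    using xy by fastforce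
  then show "((1 - t) *\<^sub>R x + t *\<^sub>R y) powr \<beta> \<le> (1 - t) * x powr \<beta> + t * y powr \<beta>"
  proof cases
    case 1
    then show ?thesis using scale[of t y] t xy by simp
  next
    case 2
    then show ?thesis using scale[of "1 - t" x] t xy by simp
  next
    case 3
    then show ?thesis
      using convex_onD[OF powr_convex[OF assms], of t x y] t by simp
  qed
qed simp

text \<open>Normalise by the expected answer T: the weights \<open>a j * K j / T\<close> sum to 1,
  and Jensen's inequality, applied pointwise to the ratios \<open>f j x / K j\<close>, reduces the
  claim to integrating each \<open>f j\<close> separately. These ratios are why the bounds are taken
  positive here.\<close>

lemma moment_bound_Minkowski_pos:
  fixes f :: "'j \<Rightarrow> 'a \<Rightarrow> real"
  assumes "\<beta> \<ge> 1" "finite J"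
    and a: "\<And>j. j \<in> J \<Longrightarrow> a j \<ge> 0" and K: "\<And>j. j \<in> J \<Longrightarrow> K j > 0"
    and f [measurable]: "\<And>j. j \<in> J \<Longrightarrow> f j \<in> borel_measurable N"
    and f0: "\<And>j x. j \<in> J \<Longrightarrow> f j x \<ge> 0"
    and g: "AE x in N. 0 \<le> g x \<and> g x \<le> (\<Sum>j\<in>J. a j * f j x)"
    and bd: "\<And>j. j \<in> J \<Longrightarrow> moment_bound N \<beta> (f j) (K j)"
  shows "moment_bound N \<beta> g (\<Sum>j\<in>J. a j * K j)"
proof (cases "(\<Sum>j\<in>J. a j * K j) = 0")
  case True
  have "\<forall>j\<in>J. a j * K j = 0"
    using True a K by (subst (asm) sum_nonneg_eq_0_iff[OF \<open>finite J\<close>]) (auto simp: less_imp_le)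
  then have "a j = 0" if "j \<in> J" for j
    using K[OF that] that by auto
  with g have "AE x in N. g x = 0"
    by auto
  then have "(\<integral>\<^sup>+x. ennreal (g x powr \<beta>) \<partial>N) = (\<integral>\<^sup>+x. 0 \<partial>N)"
    by (intro nn_integral_cong_AE) auto
  then show ?thesis
    by (simp add: moment_bound_def)
next
  case False
  define T where "T = (\<Sum>j\<in>J. a j * K j)"
  have "T \<ge> 0"
    unfolding T_def using a K by (intro sum_nonneg mult_nonneg_nonneg) (auto simp: less_imp_le)
  with False have T: "T > 0"
    by (simp add: T_def)
  have J: "J \<noteq> {}"
    using False by auto
  define w where "w j = a j * K j / T" for j
  have w0: "w j \<ge> 0" if "j \<in> J" for j
    using a[OF that] K[OF that] T by (simp add: w_def)
  have w1: "(\<Sum>j\<in>J. w j) = 1"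
    using T by (simp add: w_def T_def flip: sum_divide_distrib)
  have ptw: "(\<Sum>j\<in>J. a j * f j x) powr \<beta> \<le> T powr \<beta> * (\<Sum>j\<in>J. w j * (f j x powr \<beta> / K j powr \<beta>))" for x
  proof -
    have fK: "f j x / K j \<ge> 0" if "j \<in> J" for j
      using f0[OF that] K[OF that] by simp
    have "a j * f j x = T * (w j * (f j x / K j))" if "j \<in> J" for j
      using T K[OF that] by (simp add: w_def)
    then have "(\<Sum>j\<in>J. a j * f j x) = T * (\<Sum>j\<in>J. w j * (f j x / K j))"
      unfolding sum_distrib_left by (rule sum.cong[OF refl])
    moreover have "(\<Sum>j\<in>J. w j *\<^sub>R (f j x / K j)) powr \<beta> \<le> (\<Sum>j\<in>J. w j * (f j x / K j) powr \<beta>)"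
      using w0 w1 fK
      by (intro convex_on_sum[OF \<open>finite J\<close> J convex_on_powr_nonneg[OF \<open>\<beta> \<ge> 1\<close>]]) simp_all
    moreover have "(\<Sum>j\<in>J. w j * (f j x / K j)) \<ge> 0"
      by (intro sum_nonneg mult_nonneg_nonneg w0 fK)
    moreover have "(\<Sum>j\<in>J. w j * (f j x / K j) powr \<beta>) = (\<Sum>j\<in>J. w j * (f j x powr \<beta> / K j powr \<beta>))"
      using K by (intro sum.cong refl) (simp add: powr_divide less_imp_le f0)
    ultimately show ?thesis
      using T by (simp add: powr_mult mult_left_mono)
  qed
  have "(\<integral>\<^sup>+x. ennreal (g x powr \<beta>) \<partial>N)
      \<le> (\<integral>\<^sup>+x. ennreal (T powr \<beta> * (\<Sum>j\<in>J. w j * (f j x powr \<beta> / K j powr \<beta>))) \<partial>N)"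
    using g
  proof (intro nn_integral_mono_AE, eventually_elim)
    case (elim x)
    then have "g x powr \<beta> \<le> (\<Sum>j\<in>J. a j * f j x) powr \<beta>"
      using \<open>\<beta> \<ge> 1\<close> by (intro powr_mono2) auto
    then show ?case
      using ptw[of x] by (intro ennreal_leI) linarith
  qed
  also have "\<dots> = (\<integral>\<^sup>+x. ennreal (T powr \<beta>) * (\<Sum>j\<in>J. ennreal (w j / K j powr \<beta>) * ennreal (f j x powr \<beta>)) \<partial>N)"
    using w0 by (intro nn_integral_cong) (simp add: ennreal_mult' sum_nonneg flip: ennreal_mult'' sum_ennreal)
  also have "\<dots> = ennreal (T powr \<beta>) * (\<Sum>j\<in>J. ennreal (w j / K j powr \<beta>) * (\<integral>\<^sup>+x. ennreal (f j x powr \<beta>) \<partial>N))"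
    by (simp add: nn_integral_cmult nn_integral_sum)
  also have "\<dots> \<le> ennreal (T powr \<beta>) * (\<Sum>j\<in>J. ennreal (w j / K j powr \<beta>) * ennreal (K j powr \<beta>))"
    using bd unfolding moment_bound_def by (intro mult_left_mono sum_mono) auto
  also have "(\<Sum>j\<in>J. ennreal (w j / K j powr \<beta>) * ennreal (K j powr \<beta>)) = (\<Sum>j\<in>J. ennreal (w j))"
    using K w0 by (intro sum.cong refl) (force simp flip: ennreal_mult'')
  also have "\<dots> = 1"
    using w0 w1 by simp
  finally show ?thesis
    by (simp add: moment_bound_def T_def)
qed

text \<open>Bounds equal to 0 are reached by adding 1 / (n + 1) to every \<open>K j\<close>,
  applying the positive case and letting n tend to infinity; only the right-hand side depends on
  n.\<close>

lemma moment_bound_Minkowski: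
  fixes f :: "'j \<Rightarrow> 'a \<Rightarrow> real"
  assumes "\<beta> \<ge> 1" "finite J"
    and a: "\<And>j. j \<in> J \<Longrightarrow> a j \<ge> 0" and K: "\<And>j. j \<in> J \<Longrightarrow> K j \<ge> 0"
    and f [measurable]: "\<And>j. j \<in> J \<Longrightarrow> f j \<in> borel_measurable N"
    and f0: "\<And>j x. j \<in> J \<Longrightarrow> f j x \<ge> 0"
    and g: "AE x in N. 0 \<le> g x \<and> g x \<le> (\<Sum>j\<in>J. a j * f j x)"
    and bd: "\<And>j. j \<in> J \<Longrightarrow> moment_bound N \<beta> (f j) (K j)"
  shows "moment_bound N \<beta> g (\<Sum>j\<in>J. a j * K j)"
proof -
  define e where "e n = inverse (real (Suc n))" for n
  have e: "e n > 0" for n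
    by (simp add: e_def)
  have *: "moment_bound N \<beta> g (\<Sum>j\<in>J. a j * (K j + e n))" for n
  proof (rule moment_bound_Minkowski_pos[where f = f])
    fix j assume j: "j \<in> J"
    show "moment_bound N \<beta> (f j) (K j + e n)"
      using bd[OF j] K[OF j] e[of n] \<open>\<beta> \<ge> 1\<close> unfolding moment_bound_def
      by (elim order_trans) (intro ennreal_leI powr_mono2, auto)
  qed (use assms e in \<open>auto intro: add_nonneg_pos\<close>)
  have "(\<lambda>n. ennreal ((\<Sum>j\<in>J. a j * (K j + e n)) powr \<beta>))
      \<longlonglongrightarrow> ennreal ((\<Sum>j\<in>J. a j * (K j + 0)) powr \<beta>)"
    unfolding e_def using a K e \<open>\<beta> \<ge> 1\<close>
    by (intro tendsto_ennrealI tendsto_powr' tendsto_sum tendsto_mult tendsto_add tendsto_const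
        LIMSEQ_inverse_real_of_nat) (auto intro!: always_eventually sum_nonneg)
  then have "(\<integral>\<^sup>+x. ennreal (g x powr \<beta>) \<partial>N) \<le> ennreal ((\<Sum>j\<in>J. a j * (K j + 0)) powr \<beta>)"
    by (rule LIMSEQ_le_const) (use * in \<open>simp add: moment_bound_def\<close>)
  then show ?thesis
    by (simp add: moment_bound_def)
qed

lemma moment_bound_add:
  assumes "\<beta> \<ge> 1" "A \<ge> 0" "B \<ge> 0" "u \<in> borel_measurable N" "v \<in> borel_measurable N"
    and "\<And>x. u x \<ge> 0" "\<And>x. v x \<ge> 0" "AE x in N. 0 \<le> g x \<and> g x \<le> u x + v x"
    and "moment_bound N \<beta> u A" "moment_bound N \<beta> v B"
  shows "moment_bound N \<beta> g (A + B)"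
  using moment_bound_Minkowski[of \<beta> "UNIV :: bool set" "\<lambda>_. 1" "\<lambda>b. if b then A else B"
      "\<lambda>b. if b then u else v" N g] assms
  by (auto simp: UNIV_bool add.commute)

lemma moment_bound_mono:
  assumes "\<beta> \<ge> 0" "0 \<le> K" "K \<le> K'" "moment_bound N \<beta> f K"
  shows "moment_bound N \<beta> f K'"
  using assms unfolding moment_bound_def
  by (elim order_trans) (intro ennreal_leI powr_mono2, auto)

lemma moment_bound_distr:
  assumes "T \<in> measurable N N'" "f \<in> borel_measurable N'"
  shows "moment_bound (distr N N' T) \<beta> f K \<longleftrightarrow> moment_bound N \<beta> (\<lambda>x. f (T x)) K"
  using assms by (simp add: moment_bound_def nn_integral_distr)

lemma (in prob_space) moment_bound_const: "moment_bound M \<beta> (\<lambda>_. c) c"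
  by (simp add: moment_bound_def emeasure_space_1)

text \<open>
  Borel--Cantelli: replacing the rate \<open>r\<close> by \<open>sqrt r\<close> leaves a geometric factor that makes the
  moments summable.
\<close>

lemma AE_geometric_bound:
  assumes "\<beta> > 0" "C \<ge> 0" and r: "0 < r" "r < 1"
    and [measurable]: "\<And>m. f m \<in> borel_measurable N" and f0: "\<And>m x. f m x \<ge> 0"
    and bd: "\<And>m. moment_bound N \<beta> (f m) (C * r ^ m)"
  shows "AE x in N. \<exists>B\<ge>0. \<forall>m. f m x \<le> B * sqrt r ^ m"
proof -
  define q where "q = sqrt r"
  have q: "0 < q" "q < 1" and rq: "r = q * q"
    using r by (auto simp: q_def)
  have q\<beta>: "q powr \<beta> < 1"
    using q \<open>\<beta> > 0\<close> by (simp add: powr01_less_one)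
  have "(\<integral>\<^sup>+x. (\<Sum>m. ennreal ((f m x / q ^ m) powr \<beta>)) \<partial>N)
      = (\<Sum>m. \<integral>\<^sup>+x. ennreal ((f m x / q ^ m) powr \<beta>) \<partial>N)"
    by (intro nn_integral_suminf) simp
  also have "\<dots> \<le> (\<Sum>m. ennreal (C powr \<beta> * (q powr \<beta>) ^ m))"
  proof (intro suminf_le summableI)
    fix m
    have "(\<integral>\<^sup>+x. ennreal ((f m x / q ^ m) powr \<beta>) \<partial>N)
        = (\<integral>\<^sup>+x. ennreal (1 / (q ^ m) powr \<beta>) * ennreal (f m x powr \<beta>) \<partial>N)"
      using f0 q by (intro nn_integral_cong) (simp add: powr_divide flip: ennreal_mult'')
    also have "\<dots> = ennreal (1 / (q ^ m) powr \<beta>) * (\<integral>\<^sup>+x. ennreal (f m x powr \<beta>) \<partial>N)"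
      by (intro nn_integral_cmult) simp
    also have "\<dots> \<le> ennreal (1 / (q ^ m) powr \<beta>) * ennreal ((C * r ^ m) powr \<beta>)"
      using bd[of m] unfolding moment_bound_def by (intro mult_left_mono) auto
    also have "(C * r ^ m) powr \<beta> = C powr \<beta> * ((q ^ m) powr \<beta> * (q ^ m) powr \<beta>)"
      using q \<open>C \<ge> 0\<close> by (simp add: rq powr_mult power_mult_distrib)
    also have "ennreal (1 / (q ^ m) powr \<beta>) * ennreal \<dots> = ennreal (C powr \<beta> * (q ^ m) powr \<beta>)"
      using q by (simp flip: ennreal_mult'')
    also have "(q ^ m) powr \<beta> = (q powr \<beta>) ^ m"
      using q by (induction m) (auto simp: powr_mult)
    finally show "(\<integral>\<^sup>+x. ennreal ((f m x / q ^ m) powr \<beta>) \<partial>N) \<le> ennreal (C powr \<beta> * (q powr \<beta>) ^ m)" .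
  qed
  also have "\<dots> = ennreal (\<Sum>m. C powr \<beta> * (q powr \<beta>) ^ m)"
    using q\<beta> by (intro suminf_ennreal2 summable_mult summable_geometric) simp_all
  also have "\<dots> < \<infinity>"
    by simp
  finally have "AE x in N. (\<Sum>m. ennreal ((f m x / q ^ m) powr \<beta>)) \<noteq> \<infinity>"
    by (intro nn_integral_PInf_AE) auto
  then show ?thesis
  proof eventually_elim
    case (elim x)
    define B where "B = enn2real (\<Sum>m. ennreal ((f m x / q ^ m) powr \<beta>))"
    have B: "B \<ge> 0"
      by (simp only: B_def enn2real_nonneg)
    \<comment> \<open>Each term of the series is at most its finite sum B, so one constant serves
      every m and not only all large m.\<close>
    have "f m x \<le> B powr (1 / \<beta>) * q ^ m" for m
    proof -
      have "ennreal ((f m x / q ^ m) powr \<beta>) \<le> (\<Sum>m. ennreal ((f m x / q ^ m) powr \<beta>))"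
        by (rule order_trans[OF _ sum_le_suminf[OF summableI finite.insertI[OF finite.emptyI, of m]]])
          (simp_all only: sum.insert sum.empty finite.emptyI empty_iff not_False_eq_True add_0_right order_refl zero_le)
      also have "\<dots> = ennreal B"
        using elim by (simp add: B_def ennreal_enn2real_if)
      finally have "(f m x / q ^ m) powr \<beta> \<le> B"
        using B by (simp only: ennreal_le_iff)
      then have "((f m x / q ^ m) powr \<beta>) powr (1 / \<beta>) \<le> B powr (1 / \<beta>)"
        using \<open>\<beta> > 0\<close> by (intro powr_mono2) auto
      then show ?thesis
        using \<open>\<beta> > 0\<close> f0[of m x] q by (simp add: powr_powr pos_divide_le_eq)
    qed
    then show ?case
      unfolding q_def by (intro exI[of _ "B powr (1 / \<beta>)"]) auto
  qed
qed

section \<open>Translation of the extended-valued norms into moment bounds\<close>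

lemma epowr_le_iff:
  assumes "c > 0" "k \<ge> 0"
  shows "epowr x c \<le> ennreal k \<longleftrightarrow> x \<le> ennreal (k powr (1 / c))"
proof (cases x)
  case (real r)
  have "r powr c \<le> k \<longleftrightarrow> r \<le> k powr (1 / c)"
  proof
    assume "r powr c \<le> k"
    then have "(r powr c) powr (1 / c) \<le> k powr (1 / c)"
      using assms by (intro powr_mono2) auto
    then show "r \<le> k powr (1 / c)"
      using assms real by (simp add: powr_powr)
  next
    assume "r \<le> k powr (1 / c)"
    then have "r powr c \<le> (k powr (1 / c)) powr c"
      using assms real by (intro powr_mono2) auto
    then show "r powr c \<le> k"
      using assms real by (simp add: powr_powr)
  qed
  then show ?thesis
    using real assms by (simp add: epowr_def)
qed (auto simp: epowr_def top_unique)

lemma epowr_epowr: "epowr (epowr x a) b = epowr x (a * b)"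
  by (auto simp: epowr_def powr_powr)

lemma min_1_times_max_1: "min 1 \<alpha> * max 1 \<alpha> = (\<alpha>::real)"
  by (auto simp: min_def max_def)

text \<open>Since \<open>min 1 \<alpha> * max 1 \<alpha> = \<alpha>\<close>, the \<alpha>-th power
  of the norm is the power \<open>max 1 \<alpha>\<close> of
  \<open>norm (f \<omega>) powr min 1 \<alpha>\<close>, and the outer exponent
  \<open>min 1 \<alpha> / \<alpha>\<close> is \<open>1 / max 1 \<alpha>\<close>. This is what lets
  one argument cover both ranges of \<alpha>.\<close>

lemma epowr_Lnorm_le_iff:
  fixes f :: "'w \<Rightarrow> 'b::real_normed_vector"
  assumes "\<alpha> > 0" "k \<ge> 0"
  shows "epowr (Lnorm M \<alpha> f) (min 1 \<alpha>) \<le> ennreal k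
    \<longleftrightarrow> moment_bound M (max 1 \<alpha>) (\<lambda>\<omega>. norm (f \<omega>) powr min 1 \<alpha>) k"
proof -
  have "1 / (1 / \<alpha> * min 1 \<alpha>) = max 1 \<alpha>"
    using assms by (auto simp: min_def max_def)
  then show ?thesis
    using assms
    by (simp add: Lnorm_def epowr_epowr epowr_le_iff moment_bound_def powr_powr min_1_times_max_1
        del: times_divide_eq_left times_divide_eq_right)
qed

text \<open>Write \<open>z powr c = z * z powr (c - 1)\<close>. The second factor decreases in z
  because c \<le> 1, so replacing u + v by u or by v there can only enlarge it.\<close>

lemma powr_add_le:
  fixes u v :: real
  assumes "c \<le> 1" "0 \<le> u" "0 \<le> v"
  shows "(u + v) powr c \<le> u powr c + v powr c"
proof (cases "u = 0 \<or> v = 0")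
  case False
  then have uv: "u > 0" "v > 0"
    using assms by auto
  have split: "z powr c = z * z powr (c - 1)" if "z > 0" for z :: real
    using that by (simp add: powr_mult_base)
  have "(u + v) powr c = u * (u + v) powr (c - 1) + v * (u + v) powr (c - 1)"
    using split[of "u + v"] uv by (simp add: distrib_right)
  also have "\<dots> \<le> u * u powr (c - 1) + v * v powr (c - 1)"
    using uv assms by (intro add_mono mult_left_mono powr_mono2') auto
  finally show ?thesis
    using split[of u] split[of v] uv by simp
qed auto

lemma norm_add_powr_le:
  fixes x y :: "'b::real_normed_vector"
  assumes "0 < c" "c \<le> 1"
  shows "norm (x + y) powr c \<le> norm x powr c + norm y powr c"
proof -
  have "norm (x + y) powr c \<le> (norm x + norm y) powr c"
    using assms by (intro powr_mono2 norm_triangle_ineq) auto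
  also have "\<dots> \<le> norm x powr c + norm y powr c"
    using powr_add_le[of c "norm x" "norm y"] assms by auto
  finally show ?thesis .
qed

section \<open>Backward iteration on the space of innovation sequences\<close>

text \<open>The work is done on the canonical space \<open>S\<close> of sequences with i.i.d.
  coordinates of law \<open>Q\<close>, entry 0 being the most recent innovation; the conclusions are
  carried to other probability spaces through image measures. Completeness of \<open>'b\<close> will
  make the iterates converge.\<close>

locale contractive_recursion = sequence_space Q
  for Q :: "'e measure" +
  fixes p :: nat
    and R :: "(nat \<Rightarrow> 'b::{second_countable_topology, banach}) \<Rightarrow> 'e \<Rightarrow> 'b"
    and \<alpha> :: real and a :: "nat \<Rightarrow> real" and y\<^sub>0 :: "nat \<Rightarrow> 'b"
  assumes p: "p \<ge> 1"
    and measurable_R: "case_prod R \<in> borel_measurable (states p \<Otimes>\<^sub>M Q)"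
    and \<alpha>: "\<alpha> > 0"
    and a_nonneg: "\<And>j. j \<in> {1..p} \<Longrightarrow> a j \<ge> 0"
    and a_sum: "(\<Sum>j=1..p. a j) < 1"
    and y\<^sub>0: "y\<^sub>0 \<in> space (states p)"
    and R_contraction: "\<And>y y'. y \<in> space (states p) \<Longrightarrow> y' \<in> space (states p) \<Longrightarrow>
      moment_bound Q (max 1 \<alpha>) (\<lambda>e. norm (R y e - R y' e) powr min 1 \<alpha>)
        (\<Sum>j=1..p. a j * norm (y j - y' j) powr min 1 \<alpha>)"
    and R_start: "\<exists>K\<ge>0. moment_bound Q (max 1 \<alpha>) (\<lambda>e. norm (R y\<^sub>0 e) powr min 1 \<alpha>) K"
begin

abbreviation \<beta> :: real where "\<beta> \<equiv> max 1 \<alpha>"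

abbreviation qnorm :: "'b \<Rightarrow> real" where "qnorm x \<equiv> norm x powr min 1 \<alpha>"

abbreviation shift :: "(nat \<Rightarrow> 'e) \<Rightarrow> nat \<Rightarrow> 'e" where "shift s \<equiv> (\<lambda>k. s (Suc k))"

lemma qnorm_add_le: "qnorm (x + y) \<le> qnorm x + qnorm y"
  using \<alpha> by (intro norm_add_powr_le) auto

lemma qnorm_diff_le: "qnorm (x - z) \<le> qnorm (x - y) + qnorm (y - z)"
  using qnorm_add_le[of "x - y" "y - z"] by simp

lemma qnorm_minus_commute: "qnorm (x - y) = qnorm (y - x)"
  by (simp add: norm_minus_commute)

text \<open>The state reached from \<open>y\<^sub>0\<close> after the innovations \<open>s (m - 1), \<dots>, s 0\<close>, in this order.\<close>

primrec iter :: "nat \<Rightarrow> (nat \<Rightarrow> 'e) \<Rightarrow> nat \<Rightarrow> 'b" where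
  "iter 0 s = y\<^sub>0"
| "iter (Suc m) s = (\<lambda>j\<in>{1..p}. if j = 1 then R (iter m (shift s)) (s 0) else iter m (shift s) (j - 1))"

lemma iter_Suc_1: "iter (Suc m) s 1 = R (iter m (shift s)) (s 0)"
  using p by simp

lemma iter_Suc: "j \<in> {1..p} \<Longrightarrow> j \<noteq> 1 \<Longrightarrow> iter (Suc m) s j = iter m (shift s) (j - 1)"
  by simp

lemma measurable_R_step [measurable]:
  assumes "Y \<in> measurable N (states p)" "\<xi> \<in> measurable N Q"
  shows "(\<lambda>x. R (Y x) (\<xi> x)) \<in> borel_measurable N"
  using measurable_compose[OF measurable_Pair[OF assms] measurable_R] by simp

lemma measurable_shift [measurable]: "shift \<in> measurable S S"
  by (rule measurable_PiM_single') (auto simp: space_PiM)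

lemma measurable_state_component [measurable]:
  assumes "j \<in> {1..p}"
  shows "(\<lambda>y. y j) \<in> borel_measurable (states p)"
  using assms unfolding states_def by (rule measurable_component_singleton)

lemma measurable_iter [measurable]: "iter m \<in> measurable S (states p)"
proof (induction m)
  case 0
  then show ?case using y\<^sub>0 by simp
next
  case (Suc m)
  note [measurable] = Suc.IH
  have shifted: "(\<lambda>s. iter m (shift s)) \<in> measurable S (states p)"
    by measurable
  show ?case
    unfolding iter.simps states_def[of p]
  proof (rule measurable_restrict)
    fix j assume j: "j \<in> {1..p}"
    show "(\<lambda>s. if j = 1 then R (iter m (shift s)) (s 0) else iter m (shift s) (j - 1)) \<in> borel_measurable S"
    proof (cases "j = 1")
      case True
      then show ?thesis using shifted by (auto intro!: measurable_R_step)
    next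
      case False
      then have "j - 1 \<in> {1..p}" using j by auto
      from measurable_compose[OF shifted measurable_state_component[OF this]] False
      show ?thesis by simp
    qed
  qed
qed

lemma measurable_iter_component [measurable]:
  "j \<in> {1..p} \<Longrightarrow> (\<lambda>s. iter m s j) \<in> borel_measurable S"
  by (rule measurable_compose[OF measurable_iter measurable_state_component])

text \<open>Serves the coupling argument, where two pasts agree only in their most recent
  innovations.\<close>

lemma iter_cong: "(\<And>k. k < m \<Longrightarrow> s k = t k) \<Longrightarrow> iter m s = iter m t"
proof (induction m arbitrary: s t)
  case (Suc m)
  have "iter m (shift s) = iter m (shift t)"
    using Suc.prems by (intro Suc.IH) auto
  then show ?case
    using Suc.prems[of 0] by (simp only: iter.simps)
qed simp

lemma distr_shift: "distr S S shift = S"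
proof -
  have "distr S S (\<lambda>\<omega>. \<lambda>n\<in>UNIV. \<omega> (Suc n)) = S"
    by (rule distr_PiM_reindex) (auto intro: M.prob_space_axioms)
  then show ?thesis
    unfolding restrict_UNIV .
qed

text \<open>Treats the entries of a state that are merely copied from the previous one:
  \<open>shift\<close> preserves the law of the sequence.\<close>

lemma moment_bound_shift:
  assumes "f \<in> borel_measurable S"
  shows "moment_bound S b (\<lambda>s. f (shift s)) K \<longleftrightarrow> moment_bound S b f K"
  using moment_bound_distr[OF measurable_shift assms] distr_shift by simp

text \<open>The newest innovation \<open>s 0\<close> is independent of \<open>shift s\<close>:
  \<open>S\<close> is the image of \<open>Q \<Otimes>\<^sub>M S\<close> under
  \<open>case_nat\<close>. By Tonelli's theorem, first integrate over \<open>s 0\<close> with both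
  states frozen, which is the contraction hypothesis, and then apply Minkowski's inequality over the
  past.\<close>

lemma moment_bound_R:
  assumes Y: "Y \<in> measurable S (states p)" and Y': "Y' \<in> measurable S (states p)"
    and K: "\<And>j. j \<in> {1..p} \<Longrightarrow> K j \<ge> 0"
    and bd: "\<And>j. j \<in> {1..p} \<Longrightarrow> moment_bound S \<beta> (\<lambda>s. qnorm (Y s j - Y' s j)) (K j)"
  shows "moment_bound S \<beta> (\<lambda>s. qnorm (R (Y (shift s)) (s 0) - R (Y' (shift s)) (s 0)))
    (\<Sum>j=1..p. a j * K j)"
proof -
  note [measurable] = Y Y'
  interpret QS: pair_sigma_finite Q S
    by unfold_locales
  define h where "h s = qnorm (R (Y (shift s)) (s 0) - R (Y' (shift s)) (s 0))" for s
  have [measurable]: "h \<in> borel_measurable S"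
    unfolding h_def by measurable
  have [measurable]: "(\<lambda>x. case x of (s, \<omega>) \<Rightarrow> case_nat s \<omega>) \<in> measurable (Q \<Otimes>\<^sub>M S) S"
    by measurable
  have "(\<integral>\<^sup>+s. ennreal (h s powr \<beta>) \<partial>S)
      = (\<integral>\<^sup>+x. ennreal (h (case x of (s, \<omega>) \<Rightarrow> case_nat s \<omega>) powr \<beta>) \<partial>(Q \<Otimes>\<^sub>M S))"
    by (subst PiM_iter[symmetric], subst nn_integral_distr) auto
  also have "\<dots> = (\<integral>\<^sup>+t. \<integral>\<^sup>+e. ennreal (h (case_nat e t) powr \<beta>) \<partial>Q \<partial>S)"
    by (subst QS.nn_integral_snd[symmetric]) auto
  also have "\<dots> \<le> (\<integral>\<^sup>+t. ennreal ((\<Sum>j=1..p. a j * qnorm (Y t j - Y' t j)) powr \<beta>) \<partial>S)"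
  proof (rule nn_integral_mono)
    fix t assume "t \<in> space S"
    then have "Y t \<in> space (states p)" "Y' t \<in> space (states p)"
      by (fact measurable_space[OF Y] measurable_space[OF Y'])+
    from R_contraction[OF this]
    show "(\<integral>\<^sup>+e. ennreal (h (case_nat e t) powr \<beta>) \<partial>Q)
        \<le> ennreal ((\<Sum>j=1..p. a j * qnorm (Y t j - Y' t j)) powr \<beta>)"
      by (simp add: moment_bound_def h_def)
  qed
  also have "\<dots> \<le> ennreal ((\<Sum>j=1..p. a j * K j) powr \<beta>)"
  proof -
    have "moment_bound S \<beta> (\<lambda>t. \<Sum>j=1..p. a j * qnorm (Y t j - Y' t j)) (\<Sum>j=1..p. a j * K j)"
    proof (rule moment_bound_Minkowski[where f = "\<lambda>j t. qnorm (Y t j - Y' t j)"])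
      fix j assume "j \<in> {1..p}"
      note [measurable] = measurable_state_component[OF this]
      show "(\<lambda>t. qnorm (Y t j - Y' t j)) \<in> borel_measurable S"
        by measurable
    qed (use a_nonneg K bd in \<open>auto intro!: sum_nonneg\<close>)
    then show ?thesis
      by (simp add: moment_bound_def)
  qed
  finally show ?thesis
    by (simp add: moment_bound_def h_def)
qed

text \<open>Entry j of a state is the first entry of the state j - 1 steps earlier, so its increment
  lags behind in m; the factor \<open>1 / r ^ j\<close> pays for this delay. In the induction on m,
  entry 1 uses the contraction and every other entry the invariance under
  \<open>shift\<close>.\<close>

lemma iter_increment_bound:
  obtains C r where "C \<ge> 0" "0 < r" "r < 1"
    "\<And>m j. j \<in> {1..p} \<Longrightarrow>
      moment_bound S \<beta> (\<lambda>s. qnorm (iter (Suc m) s j - iter m s j)) (C * r ^ m / r ^ j)"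
proof -
  obtain K where K: "K \<ge> 0" "moment_bound Q \<beta> (\<lambda>e. qnorm (R y\<^sub>0 e)) K"
    using R_start by blast
  text \<open>
    With \<open>r\<^sup>p \<ge> \<Sum>j. a j\<close> we have \<open>(\<Sum>j. a j / r\<^sup>j) \<le> 1\<close>, which makes the bound \<open>C * r\<^sup>m / r\<^sup>j\<close> reproduce itself.
  \<close>
  define A where "A = max (1 / 2) (\<Sum>j=1..p. a j)"
  \<comment> \<open>The lower bound 1 / 2 keeps A positive even if all \<open>a j\<close> vanish, so
    that one may divide by powers of r.\<close>
  have A: "0 < A" "A < 1" "(\<Sum>j=1..p. a j) \<le> A"
    using a_sum by (auto simp: A_def)
  define r where "r = root p A"
  have r: "0 < r" "r < 1" and rp: "r ^ p = A"
    using A p by (auto simp: r_def)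
  \<comment> \<open>C dominates all cases of m = 0: the first two summands bound the increment of
    entry 1, the sum those of the copied entries.\<close>
  define C where "C = K + qnorm (y\<^sub>0 1) + (\<Sum>j=1..p. qnorm (y\<^sub>0 (j - 1) - y\<^sub>0 j))"
  have C: "C \<ge> 0"
    using K by (auto simp: C_def intro!: add_nonneg_nonneg sum_nonneg)
  have "moment_bound S \<beta> (\<lambda>s. qnorm (iter (Suc m) s j - iter m s j)) (C * r ^ m / r ^ j)"
    if "j \<in> {1..p}" for m j
    using that
  proof (induction m arbitrary: j)
    case 0
    have rj: "C \<le> C / r ^ j"
      using r C power_le_one[of r j] by (simp add: field_simps mult_left_le)
    have "moment_bound S \<beta> (\<lambda>s. qnorm (iter (Suc 0) s j - iter 0 s j)) C"
    proof (cases "j = 1")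
      case True
      have [measurable]: "(\<lambda>e. qnorm (R y\<^sub>0 e)) \<in> borel_measurable Q"
        using y\<^sub>0 by measurable
      have "moment_bound (distr S Q (\<lambda>s. s 0)) \<beta> (\<lambda>e. qnorm (R y\<^sub>0 e)) K"
        using K PiM_component[of 0] by simp
      then have "moment_bound S \<beta> (\<lambda>s. qnorm (R y\<^sub>0 (s 0))) K"
        by (subst (asm) moment_bound_distr) auto
      moreover have "qnorm (R y\<^sub>0 (s 0) - y\<^sub>0 1) \<le> qnorm (R y\<^sub>0 (s 0)) + qnorm (y\<^sub>0 1)" for s
        using qnorm_diff_le[of "R y\<^sub>0 (s 0)" "y\<^sub>0 1" 0] by simp
      ultimately have "moment_bound S \<beta> (\<lambda>s. qnorm (iter (Suc 0) s j - iter 0 s j)) (K + qnorm (y\<^sub>0 1))"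
        using True p K y\<^sub>0
        by (intro moment_bound_add[where u = "\<lambda>s. qnorm (R y\<^sub>0 (s 0))" and v = "\<lambda>_. qnorm (y\<^sub>0 1)"]
            moment_bound_const) auto
      then show ?thesis
        by (rule moment_bound_mono[rotated -1]) (use K in \<open>auto simp: C_def intro!: sum_nonneg\<close>)
    next
      case False
      then have "moment_bound S \<beta> (\<lambda>s. qnorm (iter (Suc 0) s j - iter 0 s j)) (qnorm (y\<^sub>0 (j - 1) - y\<^sub>0 j))"
        using 0 by (simp add: moment_bound_const)
      moreover have "qnorm (y\<^sub>0 (j - 1) - y\<^sub>0 j) \<le> K + qnorm (y\<^sub>0 1) + (\<Sum>j=1..p. qnorm (y\<^sub>0 (j - 1) - y\<^sub>0 j))"
        using 0 K member_le_sum[of j "{1..p}" "\<lambda>j. qnorm (y\<^sub>0 (j - 1) - y\<^sub>0 j)"]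
        by (simp add: add_increasing)
      ultimately show ?thesis
        by (elim moment_bound_mono[rotated -1]) (use K in \<open>auto simp: C_def\<close>)
    qed
    then show ?case
      by (rule moment_bound_mono[rotated -1]) (use rj C in auto)
  next
    case (Suc m)
    show ?case
    proof (cases "j = 1")
      case True
      have "moment_bound S \<beta>
          (\<lambda>s. qnorm (R (iter (Suc m) (shift s)) (s 0) - R (iter m (shift s)) (s 0)))
          (\<Sum>j=1..p. a j * (C * r ^ m / r ^ j))"
        by (rule moment_bound_R[OF measurable_iter measurable_iter _ Suc.IH]) (use C r in simp_all)
      moreover have "(\<Sum>j=1..p. a j * (C * r ^ m / r ^ j)) \<le> (\<Sum>j=1..p. a j * (C * r ^ m / r ^ p))"
        using C r a_nonneg
        by (intro sum_mono mult_left_mono divide_left_mono power_decreasing) auto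
      moreover have "(\<Sum>j=1..p. a j * (C * r ^ m / r ^ p)) \<le> C * r ^ m"
        unfolding sum_distrib_right[symmetric] rp
        using A C r mult_right_mono[OF A(3), of "C * r ^ m / A"] by simp
      moreover have "(\<Sum>j=1..p. a j * (C * r ^ m / r ^ j)) \<ge> 0"
        using C r a_nonneg by (auto intro!: sum_nonneg)
      ultimately have "moment_bound S \<beta>
          (\<lambda>s. qnorm (R (iter (Suc m) (shift s)) (s 0) - R (iter m (shift s)) (s 0))) (C * r ^ m)"
        by (elim moment_bound_mono[rotated -1]) auto
      moreover have "C * r ^ m = C * r ^ Suc m / r ^ j"
        using True r by simp
      ultimately show ?thesis
        by (simp only: True iter_Suc_1)
    next
      case False
      then have j: "j - 1 \<in> {1..p}" "j \<noteq> 1" "j \<ge> 1"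
        using Suc.prems by auto
      note [measurable] = measurable_iter_component[OF j(1)]
      have meas: "(\<lambda>s. qnorm (iter (Suc m) s (j - 1) - iter m s (j - 1))) \<in> borel_measurable S"
        by measurable
      have "moment_bound S \<beta> (\<lambda>s. qnorm (iter (Suc m) (shift s) (j - 1) - iter m (shift s) (j - 1)))
          (C * r ^ m / r ^ (j - 1))"
        using Suc.IH[OF j(1)] moment_bound_shift[OF meas] by (simp only:)
      moreover have "C * r ^ m / r ^ (j - 1) = C * r ^ Suc m / r ^ j"
        using j r by (cases j) auto
      ultimately show ?thesis
        by (simp only: iter_Suc[OF Suc.prems False])
    qed
  qed
  with C r that show ?thesis
    by blast
qed

section \<open>Convergence of the iterates and the recursion for the limit\<close>

declare iter.simps [simp del]

text \<open>As \<open>lim\<close> is total, the limit is a measurable function on all of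
  \<open>S\<close> before any convergence is known.\<close>

definition limit_state :: "(nat \<Rightarrow> 'e) \<Rightarrow> nat \<Rightarrow> 'b" where
  "limit_state s = (\<lambda>j\<in>{1..p}. Topological_Spaces.lim (\<lambda>m. iter m s j))"

definition G :: "(nat \<Rightarrow> 'e) \<Rightarrow> 'b" where
  "G s = limit_state s 1"

lemma measurable_limit_state [measurable]: "limit_state \<in> measurable S (states p)"
  unfolding limit_state_def states_def by (rule measurable_restrict) simp

lemma measurable_G [measurable]: "G \<in> borel_measurable S"
  unfolding G_def by (rule measurable_compose[OF measurable_limit_state measurable_state_component]) (use p in simp)

text \<open>
  This holds at every \<open>s\<close>, even where the limits do not exist: \<open>lim X\<close> is a definite description that depends
  only on the limits of \<open>X\<close>.
\<close>

lemma limit_state_eq_G: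
  assumes "j \<in> {1..p}"
  shows "limit_state s j = G (\<lambda>k. s (k + (j - 1)))"
  using assms
proof (induction j arbitrary: s)
  case (Suc j)
  show ?case
  proof (cases "j = 0")
    case False
    then have j: "j \<in> {1..p}" "Suc j \<in> {1..p}" using Suc.prems by auto
    have "(\<lambda>m. iter m s (Suc j)) \<longlonglongrightarrow> l \<longleftrightarrow> (\<lambda>m. iter m (shift s) j) \<longlonglongrightarrow> l" for l
      using j by (subst filterlim_sequentially_Suc[symmetric]) (simp add: iter_Suc)
    then have "limit_state s (Suc j) = limit_state (shift s) j"
      using j by (simp add: limit_state_def Topological_Spaces.lim_def)
    also have "\<dots> = G (\<lambda>k. shift s (k + (j - 1)))"
      by (rule Suc.IH[OF j(1)])
    also have "\<dots> = G (\<lambda>k. s (k + (Suc j - 1)))"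
      using j by (intro arg_cong[of _ _ G]) auto
    finally show ?thesis .
  qed (simp add: G_def)
qed simp

text \<open>Almost surely the increments are dominated by a geometric sequence, so the telescoping
  series of increments converges absolutely.\<close>

lemma AE_iter_tendsto:
  assumes j: "j \<in> {1..p}"
  shows "AE s in S. (\<lambda>m. iter m s j) \<longlonglongrightarrow> limit_state s j"
proof -
  obtain C r where C: "C \<ge> 0" and r: "0 < r" "r < 1"
    and bd: "\<And>m j. j \<in> {1..p} \<Longrightarrow>
      moment_bound S \<beta> (\<lambda>s. qnorm (iter (Suc m) s j - iter m s j)) (C * r ^ m / r ^ j)"
    by (rule iter_increment_bound) blast
  note [measurable] = measurable_iter_component[OF j]
  have "AE s in S. \<exists>B\<ge>0. \<forall>m. qnorm (iter (Suc m) s j - iter m s j) \<le> B * sqrt r ^ m"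
  proof (rule AE_geometric_bound[where C = "C / r ^ j" and \<beta> = \<beta>])
    show "moment_bound S \<beta> (\<lambda>s. qnorm (iter (Suc m) s j - iter m s j)) (C / r ^ j * r ^ m)" for m
      using bd[OF j, of m] by simp
  qed (use C r in simp_all)
  then show ?thesis
  proof eventually_elim
    case (elim s)
    then obtain B where B: "B \<ge> 0" "\<And>m. qnorm (iter (Suc m) s j - iter m s j) \<le> B * sqrt r ^ m"
      by blast
    \<comment> \<open>The power c undoes the one in \<open>qnorm\<close>; it alters the rate but
      keeps it below 1.\<close>
    define c where "c = 1 / min 1 \<alpha>"
    have c: "c > 0" "min 1 \<alpha> * c = 1"
      using \<alpha> by (auto simp: c_def)
    have sq: "0 < sqrt r" "sqrt r < 1"
      using r by auto
    have "norm (iter (Suc m) s j - iter m s j) \<le> B powr c * (sqrt r powr c) ^ m" for m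
    proof -
      have "qnorm (iter (Suc m) s j - iter m s j) powr c \<le> (B * sqrt r ^ m) powr c"
        using B c by (intro powr_mono2) auto
      also have "\<dots> = B powr c * (sqrt r ^ m) powr c"
        using B sq by (simp add: powr_mult)
      also have "(sqrt r ^ m) powr c = (sqrt r powr c) ^ m"
        using sq by (induction m) (auto simp: powr_mult)
      finally show ?thesis
        using c by (simp add: powr_powr)
    qed
    note bound = this
    have "summable (\<lambda>m. B powr c * (sqrt r powr c) ^ m)"
      using sq c by (intro summable_mult summable_geometric) (simp add: powr01_less_one)
    then have "summable (\<lambda>m. iter (Suc m) s j - iter m s j)"
      by (rule summable_comparison_test'[OF _ bound])
    then have "(\<lambda>n. \<Sum>m<n. iter (Suc m) s j - iter m s j) \<longlonglongrightarrow> (\<Sum>m. iter (Suc m) s j - iter m s j)"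
      by (rule summable_LIMSEQ)
    then have "(\<lambda>n. iter n s j - iter 0 s j) \<longlonglongrightarrow> (\<Sum>m. iter (Suc m) s j - iter m s j)"
      by (simp only: sum_lessThan_telescope[of "\<lambda>n. iter n s j"])
    from tendsto_add[OF this tendsto_const[of "iter 0 s j"]]
    have "(\<lambda>n. iter n s j) \<longlonglongrightarrow> (\<Sum>m. iter (Suc m) s j - iter m s j) + iter 0 s j"
      by (simp only: diff_add_cancel)
    then have "convergent (\<lambda>n. iter n s j)"
      by (rule convergentI)
    then show ?case
      using j by (simp add: limit_state_def convergent_LIMSEQ_iff)
  qed
qed

text \<open>Minkowski's inequality over the increments from m to m + n gives a bound uniform in n,
  and Fatou's lemma carries it to the limit.\<close>

lemma iter_limit_bound:
  obtains C r where "C \<ge> 0" "0 < r" "r < 1"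
    "\<And>m j. j \<in> {1..p} \<Longrightarrow> moment_bound S \<beta> (\<lambda>s. qnorm (iter m s j - limit_state s j)) (C * r ^ m)"
proof -
  obtain C r where C: "C \<ge> 0" and r: "0 < r" "r < 1"
    and bd: "\<And>m j. j \<in> {1..p} \<Longrightarrow>
      moment_bound S \<beta> (\<lambda>s. qnorm (iter (Suc m) s j - iter m s j)) (C * r ^ m / r ^ j)"
    by (rule iter_increment_bound) blast
  \<comment> \<open>Replacing \<open>r ^ j\<close> by the smaller \<open>r ^ p\<close> makes the
    constant uniform in j; \<open>1 / (1 - r)\<close> sums the geometric tail.\<close>
  define D where "D = C / r ^ p / (1 - r)"
  have D: "D \<ge> 0"
    using C r by (simp add: D_def)
  have "moment_bound S \<beta> (\<lambda>s. qnorm (iter m s j - limit_state s j)) (D * r ^ m)"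
    if j: "j \<in> {1..p}" for m j
  proof -
    note [measurable] = measurable_iter_component[OF j] measurable_state_component[OF j]
    have step: "moment_bound S \<beta> (\<lambda>s. qnorm (iter m s j - iter (m + n) s j)) (D * r ^ m)" for n
    proof -
      have "moment_bound S \<beta> (\<lambda>s. qnorm (iter m s j - iter (m + n) s j))
          (\<Sum>i<n. 1 * (C * r ^ (m + i) / r ^ j))"
      proof (rule moment_bound_Minkowski[where f = "\<lambda>i s. qnorm (iter (Suc (m + i)) s j - iter (m + i) s j)"])
        have "qnorm (iter m s j - iter (m + n) s j)
            \<le> (\<Sum>i<n. qnorm (iter (Suc (m + i)) s j - iter (m + i) s j))" for s
        proof (induction n)
          case (Suc n)
          then show ?case
            using qnorm_diff_le[of "iter m s j" "iter (m + Suc n) s j" "iter (m + n) s j"]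
              qnorm_minus_commute[of "iter (m + Suc n) s j" "iter (m + n) s j"]
            by simp
        qed simp
        then show "AE s in S. 0 \<le> qnorm (iter m s j - iter (m + n) s j) \<and>
            qnorm (iter m s j - iter (m + n) s j)
              \<le> (\<Sum>i<n. 1 * qnorm (iter (Suc (m + i)) s j - iter (m + i) s j))"
          by simp
        show "moment_bound S \<beta> (\<lambda>s. qnorm (iter (Suc (m + i)) s j - iter (m + i) s j))
            (C * r ^ (m + i) / r ^ j)" for i
          by (rule bd[OF j])
      qed (use C r in auto)
      moreover have "(\<Sum>i<n. 1 * (C * r ^ (m + i) / r ^ j)) \<le> D * r ^ m"
      proof -
        have "(\<Sum>i<n. 1 * (C * r ^ (m + i) / r ^ j)) = C * r ^ m / r ^ j * (\<Sum>i<n. r ^ i)"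
          by (simp add: power_add sum_distrib_left mult.assoc)
        also have "\<dots> \<le> C * r ^ m / r ^ p * (1 / (1 - r))"
        proof (rule mult_mono)
          show "C * r ^ m / r ^ j \<le> C * r ^ m / r ^ p"
            using C r j by (intro divide_left_mono power_decreasing) auto
          have "(\<Sum>i<n. r ^ i) \<le> (\<Sum>i. r ^ i)"
            using r by (intro sum_le_suminf summable_geometric) auto
          then show "(\<Sum>i<n. r ^ i) \<le> 1 / (1 - r)"
            using r by (simp add: suminf_geometric)
        qed (use C r in \<open>auto intro!: sum_nonneg\<close>)
        finally show ?thesis
          by (simp add: D_def)
      qed
      moreover have "(\<Sum>i<n. 1 * (C * r ^ (m + i) / r ^ j)) \<ge> 0"
        using C r by (auto intro!: sum_nonneg)
      ultimately show ?thesis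
        by (elim moment_bound_mono[rotated -1]) auto
    qed
    have "(\<integral>\<^sup>+s. ennreal (qnorm (iter m s j - limit_state s j) powr \<beta>) \<partial>S)
        = (\<integral>\<^sup>+s. liminf (\<lambda>n. ennreal (qnorm (iter m s j - iter (m + n) s j) powr \<beta>)) \<partial>S)"
    proof (rule nn_integral_cong_AE, use AE_iter_tendsto[OF j] in eventually_elim)
      case (elim s)
      then have "(\<lambda>n. iter (m + n) s j) \<longlonglongrightarrow> limit_state s j"
        using LIMSEQ_ignore_initial_segment[of "\<lambda>n. iter n s j" "limit_state s j" m]
        by (simp add: add.commute)
      then have "(\<lambda>n. ennreal (qnorm (iter m s j - iter (m + n) s j) powr \<beta>))
          \<longlonglongrightarrow> ennreal (qnorm (iter m s j - limit_state s j) powr \<beta>)"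
        using \<alpha> by (intro tendsto_ennrealI tendsto_powr' tendsto_norm tendsto_diff tendsto_const) auto
      then show ?case
        by (intro lim_imp_Liminf[symmetric]) auto
    qed
    \<comment> \<open>Fatou's lemma, after the integrand has been identified almost everywhere as a
      liminf.\<close>
    also have "\<dots> \<le> liminf (\<lambda>n. \<integral>\<^sup>+s. ennreal (qnorm (iter m s j - iter (m + n) s j) powr \<beta>) \<partial>S)"
      by (intro nn_integral_liminf) measurable
    also have "\<dots> \<le> liminf (\<lambda>n::nat. ennreal ((D * r ^ m) powr \<beta>))"
      using step by (intro Liminf_mono always_eventually) (simp add: moment_bound_def)
    also have "\<dots> = ennreal ((D * r ^ m) powr \<beta>)"
      by (simp add: Liminf_const)
    finally show ?thesis
      by (simp add: moment_bound_def)
  qed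
  with D r that show ?thesis
    by blast
qed

text \<open>The contraction holds in moments only and gives no continuity of R in the state for a
  fixed innovation, so the limit is not taken pathwise. Instead the distance h between the two sides
  is compared with \<open>iter (Suc m) s 1\<close>, its moment is bounded by a multiple of
  \<open>r ^ m\<close> for every m, and hence it vanishes almost surely.\<close>

lemma AE_G_recursion: "AE s in S. G s = R (\<lambda>j\<in>{1..p}. G (\<lambda>k. s (k + j))) (s 0)"
proof -
  obtain C r where C: "C \<ge> 0" and r: "0 < r" "r < 1"
    and bd: "\<And>m j. j \<in> {1..p} \<Longrightarrow>
      moment_bound S \<beta> (\<lambda>s. qnorm (iter m s j - limit_state s j)) (C * r ^ m)"
    by (rule iter_limit_bound) blast
  \<comment> \<open>The lag is j and not j - 1, because \<open>shift\<close> adds one step to that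
    of \<open>limit_state_eq_G\<close>.\<close>
  have shifted: "limit_state (shift s) = (\<lambda>j\<in>{1..p}. G (\<lambda>k. s (k + j)))" for s
  proof
    fix j
    show "limit_state (shift s) j = (\<lambda>j\<in>{1..p}. G (\<lambda>k. s (k + j))) j"
    proof (cases "j \<in> {1..p}")
      case True
      then have "(\<lambda>k. s (Suc (k + (j - 1)))) = (\<lambda>k. s (k + j))"
        by (intro ext arg_cong[of _ _ s]) auto
      with True show ?thesis
        by (simp add: limit_state_eq_G)
    qed (auto simp: limit_state_def)
  qed
  define h where "h s = qnorm (G s - R (limit_state (shift s)) (s 0))" for s
  have [measurable]: "h \<in> borel_measurable S"
    unfolding h_def by measurable
  \<comment> \<open>The 1 accounts for replacing \<open>G s\<close> by an iterate, the sum for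
    replacing the limit state inside R.\<close>
  define T where "T = C * (1 + (\<Sum>j=1..p. a j))"
  have T: "T \<ge> 0"
    using C a_nonneg by (auto simp: T_def intro!: mult_nonneg_nonneg add_nonneg_nonneg sum_nonneg)
  have h_bound: "moment_bound S \<beta> h (T * r ^ m)" for m
  proof -
    have one: "1 \<in> {1..p}"
      using p by simp
    note [measurable] = measurable_iter_component[OF one]
    have u: "moment_bound S \<beta> (\<lambda>s. qnorm (iter (Suc m) s 1 - G s)) (C * r ^ m)"
      using bd[OF one, of "Suc m"] C r unfolding G_def
      by (elim moment_bound_mono[rotated -1]) (auto intro!: mult_left_mono mult_left_le_one_le)
    have v: "moment_bound S \<beta> (\<lambda>s. qnorm (R (iter m (shift s)) (s 0) - R (limit_state (shift s)) (s 0)))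
        (\<Sum>j=1..p. a j * (C * r ^ m))"
      using C r bd by (intro moment_bound_R measurable_iter measurable_limit_state) auto
    have h_le: "h s \<le> qnorm (iter (Suc m) s 1 - G s)
        + qnorm (R (iter m (shift s)) (s 0) - R (limit_state (shift s)) (s 0))" for s
      using qnorm_diff_le[of "G s" "R (limit_state (shift s)) (s 0)" "iter (Suc m) s 1"]
      unfolding h_def iter_Suc_1 qnorm_minus_commute[of "R (iter m (shift s)) (s 0)" "G s"]
      by simp
    have "moment_bound S \<beta> h (C * r ^ m + (\<Sum>j=1..p. a j * (C * r ^ m)))"
    proof (rule moment_bound_add[OF _ _ _ _ _ _ _ _ u v])
      show "0 \<le> (\<Sum>j=1..p. a j * (C * r ^ m))"
        using C r a_nonneg by (auto intro!: sum_nonneg)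
      show "(\<lambda>s. qnorm (iter (Suc m) s 1 - G s)) \<in> borel_measurable S"
        "(\<lambda>s. qnorm (R (iter m (shift s)) (s 0) - R (limit_state (shift s)) (s 0))) \<in> borel_measurable S"
        by measurable
      show "AE s in S. 0 \<le> h s \<and> h s \<le> qnorm (iter (Suc m) s 1 - G s)
          + qnorm (R (iter m (shift s)) (s 0) - R (limit_state (shift s)) (s 0))"
        by (intro AE_I2 conjI h_le) (simp add: h_def)
    qed (use C r in simp_all)
    moreover have "C * r ^ m + (\<Sum>j=1..p. a j * (C * r ^ m)) = T * r ^ m"
      by (simp add: T_def algebra_simps flip: sum_distrib_left sum_distrib_right)
    ultimately show ?thesis
      by simp
  qed
  have "(\<lambda>m. ennreal ((T * r ^ m) powr \<beta>)) \<longlonglongrightarrow> ennreal ((T * 0) powr \<beta>)"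
    using \<alpha> r T by (intro tendsto_ennrealI tendsto_powr' tendsto_mult tendsto_const LIMSEQ_power_zero) auto
  then have "(\<integral>\<^sup>+s. ennreal (h s powr \<beta>) \<partial>S) \<le> ennreal ((T * 0) powr \<beta>)"
    by (rule LIMSEQ_le_const) (use h_bound in \<open>simp add: moment_bound_def\<close>)
  then have "(\<integral>\<^sup>+s. ennreal (h s powr \<beta>) \<partial>S) = 0"
    by simp
  then have "AE s in S. ennreal (h s powr \<beta>) = 0"
    by (subst (asm) nn_integral_0_iff_AE) auto
  then show ?thesis
    by eventually_elim (simp add: h_def shifted)
qed

section \<open>Coupling of two pasts that share the latest innovations\<close>

text \<open>\<open>comb_seq n s t\<close> has the entries of s below n, followed by t. It again has
  law \<open>S\<close>, and \<open>iter n\<close> cannot tell it from s, so both values of G are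
  close to the same iterate by \<open>iter_limit_bound\<close>.\<close>

lemma G_coupling_bound:
  "\<exists>C r. 0 < C \<and> 0 < r \<and> r < 1 \<and> (\<forall>n.
     (\<integral>\<^sup>+x. ennreal (norm (G (comb_seq n (fst x) (snd x)) - G (fst x)) powr \<alpha>) \<partial>(S \<Otimes>\<^sub>M S))
       \<le> ennreal (C * r ^ n))"
proof -
  obtain C r where C: "C \<ge> 0" and r: "0 < r" "r < 1"
    and bd: "\<And>m j. j \<in> {1..p} \<Longrightarrow>
      moment_bound S \<beta> (\<lambda>s. qnorm (iter m s j - limit_state s j)) (C * r ^ m)"
    by (rule iter_limit_bound) blast
  interpret SS: pair_prob_space S S
    by unfold_locales
  have one: "1 \<in> {1..p}"
    using p by simp
  note [measurable] = measurable_iter_component[OF one]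
  have "(\<integral>\<^sup>+x. ennreal (norm (G (comb_seq n (fst x) (snd x)) - G (fst x)) powr \<alpha>) \<partial>(S \<Otimes>\<^sub>M S))
      \<le> ennreal ((2 * C + 1) powr \<beta> * (r powr \<beta>) ^ n)" for n
  proof -
    define g where "g s = qnorm (iter n s 1 - G s)" for s
    have [measurable]: "g \<in> borel_measurable S"
      unfolding g_def by measurable
    have g: "moment_bound S \<beta> g (C * r ^ n)"
      using bd[OF one, of n] by (simp add: g_def[abs_def] G_def)
    have 1: "moment_bound (S \<Otimes>\<^sub>M S) \<beta> (\<lambda>x. g (comb_seq n (fst x) (snd x))) (C * r ^ n)"
    proof -
      have "moment_bound (distr (S \<Otimes>\<^sub>M S) S (\<lambda>(s, t). comb_seq n s t)) \<beta> g (C * r ^ n)"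
        using g by (simp only: PiM_comb_seq)
      then show ?thesis
        by (subst (asm) moment_bound_distr) (simp_all add: split_beta')
    qed
    have 2: "moment_bound (S \<Otimes>\<^sub>M S) \<beta> (\<lambda>x. g (fst x)) (C * r ^ n)"
    proof -
      have "distr (S \<Otimes>\<^sub>M S) S fst = S"
        by (rule P.distr_pair_fst)
      with g show ?thesis
        using moment_bound_distr[of fst "S \<Otimes>\<^sub>M S" S g \<beta> "C * r ^ n"] by simp
    qed
    have le: "qnorm (G (comb_seq n s t) - G s) \<le> g (comb_seq n s t) + g s" for s t
    proof -
      have "iter n (comb_seq n s t) = iter n s"
        by (rule iter_cong) (simp add: comb_seq_less)
      then show ?thesis
        using qnorm_diff_le[of "G (comb_seq n s t)" "G s" "iter n s 1"]
        by (simp add: g_def qnorm_minus_commute[of "G (comb_seq n s t)"])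
    qed
    have "moment_bound (S \<Otimes>\<^sub>M S) \<beta>
        (\<lambda>x. qnorm (G (comb_seq n (fst x) (snd x)) - G (fst x))) (C * r ^ n + C * r ^ n)"
    proof (rule moment_bound_add[OF _ _ _ _ _ _ _ _ 1 2])
      show "g (comb_seq n (fst x) (snd x)) \<ge> 0" "g (fst x) \<ge> 0" for x :: "(nat \<Rightarrow> 'e) \<times> (nat \<Rightarrow> 'e)"
        by (simp_all add: g_def)
    qed (use C r le in simp_all)
    then have "moment_bound (S \<Otimes>\<^sub>M S) \<beta>
        (\<lambda>x. qnorm (G (comb_seq n (fst x) (snd x)) - G (fst x))) ((2 * C + 1) * r ^ n)"
      by (rule moment_bound_mono[rotated -1]) (use C r in \<open>auto simp: algebra_simps\<close>)
    moreover have "((2 * C + 1) * r ^ n) powr \<beta> = (2 * C + 1) powr \<beta> * (r ^ n) powr \<beta>"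
      using C r by (simp add: powr_mult)
    moreover have "(r ^ n) powr \<beta> = (r powr \<beta>) ^ n"
      using r by (induction n) (auto simp: powr_mult)
    ultimately show ?thesis
      by (simp only: moment_bound_def powr_powr min_1_times_max_1)
  qed
  \<comment> \<open>Adding 1 to 2 * C makes the constant positive even if C = 0. The power \<beta>
    enters because the \<alpha>-th moment of the norm is the \<beta>-th moment of
    \<open>qnorm\<close>.\<close>
  moreover have "0 < (2 * C + 1) powr \<beta>" "0 < r powr \<beta>" "r powr \<beta> < 1"
    using C r by (auto simp: powr01_less_one)
  ultimately show ?thesis
    by blast
qed

end

section \<open>Subfamilies of i.i.d. families, Lipschitz coefficients and stationarity\<close>

lemma powr_sum_le:
  fixes f :: "'j \<Rightarrow> real"
  assumes "0 < c" "c \<le> 1" "finite J" "\<And>j. j \<in> J \<Longrightarrow> f j \<ge> 0"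
  shows "(\<Sum>j\<in>J. f j) powr c \<le> (\<Sum>j\<in>J. f j powr c)"
  using assms(3,4)
proof (induction J)
  case (insert j J)
  have "(f j + (\<Sum>j\<in>J. f j)) powr c \<le> f j powr c + (\<Sum>j\<in>J. f j) powr c"
    using assms insert.prems by (intro powr_add_le sum_nonneg) auto
  also have "\<dots> \<le> f j powr c + (\<Sum>j\<in>J. f j powr c)"
    using insert by simp
  finally show ?case
    using insert.hyps by simp
qed simp

lemma epowr_less_infinity: "x < \<infinity> \<Longrightarrow> epowr x c < \<infinity>"
  by (auto simp: epowr_def)

text \<open>Independence turns the joint law of the whole family into a product measure, and
  reindexing a product of equal factors along an injection again gives such a product. This covers
  both one-sided pasts and shifts of the two-sided sequence.\<close>

lemma distr_iid_reindex:
  fixes X :: "'i \<Rightarrow> 'w \<Rightarrow> 'e" and f :: "'k \<Rightarrow> 'i"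
  assumes "prob_space M" and iid: "iid M S X UNIV" and "inj f"
  shows "(\<lambda>\<omega> k. X (f k) \<omega>) \<in> measurable M (\<Pi>\<^sub>M k\<in>UNIV. S)"
    and "distr M (\<Pi>\<^sub>M k\<in>UNIV. S) (\<lambda>\<omega> k. X (f k) \<omega>) = (\<Pi>\<^sub>M k\<in>UNIV. distr M S (X i))"
proof -
  interpret prob_space M by fact
  have indep: "indep_vars (\<lambda>_. S) X UNIV" and dist: "distr M S (X j) = distr M S (X i)" for j
    using iid by (auto simp: iid_def)
  have X: "X j \<in> measurable M S" for j
    using indep by (auto simp: indep_vars_def)
  define Q where "Q = distr M S (X i)"
  have sets_Q: "sets Q = sets S"
    by (simp add: Q_def)
  have dist_Q: "distr M S (X j) = Q" for j
    unfolding Q_def by (rule dist)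
  have law: "distr M (\<Pi>\<^sub>M j\<in>UNIV. S) (\<lambda>\<omega> j. X j \<omega>) = (\<Pi>\<^sub>M j\<in>UNIV. Q)"
    using indep indep_vars_iff_distr_eq_PiM[where I = UNIV and M' = "\<lambda>_. S" and X = X] unfolding restrict_UNIV
    by (simp add: dist_Q X)
  have X_meas: "(\<lambda>\<omega> j. X j \<omega>) \<in> measurable M (\<Pi>\<^sub>M j\<in>UNIV. S)"
    by (rule measurable_PiM_single') (use X measurable_space[OF X] in auto)
  have proj: "(\<lambda>x k. x (f k)) \<in> measurable (\<Pi>\<^sub>M j\<in>UNIV. S) (\<Pi>\<^sub>M k\<in>UNIV. S)"
    by (rule measurable_PiM_single') (auto simp: space_PiM)
  show "(\<lambda>\<omega> k. X (f k) \<omega>) \<in> measurable M (\<Pi>\<^sub>M k\<in>UNIV. S)"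
    using measurable_compose[OF X_meas proj] .
  have "distr (\<Pi>\<^sub>M j\<in>UNIV. Q) (\<Pi>\<^sub>M k\<in>UNIV. Q) (\<lambda>x. \<lambda>k\<in>UNIV. x (f k)) = (\<Pi>\<^sub>M k\<in>UNIV. Q)"
    using \<open>inj f\<close> by (intro distr_PiM_reindex) (auto simp: Q_def intro!: prob_space_distr X)
  then have "distr (\<Pi>\<^sub>M j\<in>UNIV. Q) (\<Pi>\<^sub>M k\<in>UNIV. Q) (\<lambda>x k. x (f k)) = (\<Pi>\<^sub>M k\<in>UNIV. Q)"
    unfolding restrict_UNIV .
  moreover have "distr M (\<Pi>\<^sub>M k\<in>UNIV. S) (\<lambda>\<omega> k. X (f k) \<omega>)
      = distr (distr M (\<Pi>\<^sub>M j\<in>UNIV. S) (\<lambda>\<omega> j. X j \<omega>)) (\<Pi>\<^sub>M k\<in>UNIV. S) (\<lambda>x k. x (f k))"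
    using distr_distr[OF proj X_meas] by (simp add: comp_def)
  moreover have "distr (\<Pi>\<^sub>M j\<in>UNIV. Q) (\<Pi>\<^sub>M k\<in>UNIV. S) (\<lambda>x k. x (f k))
      = distr (\<Pi>\<^sub>M j\<in>UNIV. Q) (\<Pi>\<^sub>M k\<in>UNIV. Q) (\<lambda>x k. x (f k))"
    by (intro distr_cong sets_PiM_cong refl) (simp add: sets_Q)
  ultimately show "distr M (\<Pi>\<^sub>M k\<in>UNIV. S) (\<lambda>\<omega> k. X (f k) \<omega>) = (\<Pi>\<^sub>M k\<in>UNIV. distr M S (X i))"
    by (simp only: law flip: Q_def)
qed

text \<open>Entry k of the past at time n belongs to time n - k, which is positive exactly for k <
  n. For k \<ge> n that time is -(k - n), that is, entry k - n of the past of \<open>e'\<close> at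
  time 0.\<close>

lemma past_mixed_eq_comb_seq:
  "past (\<lambda>i. if i \<le> 0 then e' i else e i) (int n) = comb_seq n (past e (int n)) (past e' 0)"
  by (auto simp: past_def comb_seq_def fun_eq_iff of_nat_diff)

text \<open>Subadditivity of the power \<open>min 1 \<alpha>\<close> bounds each path by a sum over
  j. Minkowski's inequality then applies with the deterministic state distances as coefficients and
  the powers of \<open>norm (H j (\<eta> \<omega>))\<close> as functions.\<close>

lemma contraction_of_Lipschitz:
  fixes R :: "(nat \<Rightarrow> 'b::{second_countable_topology, real_normed_vector}) \<Rightarrow> 'e \<Rightarrow> 'b"
    and H :: "nat \<Rightarrow> 'e \<Rightarrow> real"
  assumes "\<alpha> > 0" and \<eta> [measurable]: "\<eta> \<in> measurable M S"
    and H [measurable]: "\<And>j. j \<in> {1..p} \<Longrightarrow> H j \<in> borel_measurable S"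
    and Lip: "\<And>y y'. y \<in> space (states p) \<Longrightarrow> y' \<in> space (states p) \<Longrightarrow> AE \<omega> in M.
      norm (R y (\<eta> \<omega>) - R y' (\<eta> \<omega>)) \<le> (\<Sum>j=1..p. H j (\<eta> \<omega>) * norm (y j - y' j))"
    and a: "\<And>j. j \<in> {1..p} \<Longrightarrow> a j \<ge> 0"
    and H_bound: "\<And>j. j \<in> {1..p} \<Longrightarrow>
      epowr (Lnorm M \<alpha> (\<lambda>\<omega>. H j (\<eta> \<omega>))) (min 1 \<alpha>) \<le> ennreal (a j)"
  shows "contraction M p R \<eta> \<alpha> a"
  unfolding contraction_def
proof (intro ballI)
  fix y y' :: "nat \<Rightarrow> 'b"
  assume y: "y \<in> space (states p)" "y' \<in> space (states p)"
  have "moment_bound M (max 1 \<alpha>) (\<lambda>\<omega>. norm (R y (\<eta> \<omega>) - R y' (\<eta> \<omega>)) powr min 1 \<alpha>)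
      (\<Sum>j=1..p. norm (y j - y' j) powr min 1 \<alpha> * a j)"
  proof (rule moment_bound_Minkowski[where f = "\<lambda>j \<omega>. norm (H j (\<eta> \<omega>)) powr min 1 \<alpha>"])
    show "AE \<omega> in M. 0 \<le> norm (R y (\<eta> \<omega>) - R y' (\<eta> \<omega>)) powr min 1 \<alpha> \<and>
        norm (R y (\<eta> \<omega>) - R y' (\<eta> \<omega>)) powr min 1 \<alpha>
          \<le> (\<Sum>j=1..p. norm (y j - y' j) powr min 1 \<alpha> * norm (H j (\<eta> \<omega>)) powr min 1 \<alpha>)"
      using Lip[OF y]
    proof eventually_elim
      case (elim \<omega>)
      \<comment> \<open>H carries no sign condition; passing to its absolute value makes every
        summand nonnegative before powers are taken.\<close>
      also have "(\<Sum>j=1..p. H j (\<eta> \<omega>) * norm (y j - y' j))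
          \<le> (\<Sum>j=1..p. norm (y j - y' j) * norm (H j (\<eta> \<omega>)))"
        by (intro sum_mono) (simp add: mult.commute[of "norm _"] mult_right_mono)
      finally have "norm (R y (\<eta> \<omega>) - R y' (\<eta> \<omega>)) powr min 1 \<alpha>
          \<le> (\<Sum>j=1..p. norm (y j - y' j) * norm (H j (\<eta> \<omega>))) powr min 1 \<alpha>"
        using \<open>\<alpha> > 0\<close> by (intro powr_mono2) auto
      also have "\<dots> \<le> (\<Sum>j=1..p. (norm (y j - y' j) * norm (H j (\<eta> \<omega>))) powr min 1 \<alpha>)"
        using \<open>\<alpha> > 0\<close> by (intro powr_sum_le) auto
      finally show ?case
        by (simp add: powr_mult)
    qed
    fix j assume j: "j \<in> {1..p}"
    show "moment_bound M (max 1 \<alpha>) (\<lambda>\<omega>. norm (H j (\<eta> \<omega>)) powr min 1 \<alpha>) (a j)"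
      using iffD1[OF epowr_Lnorm_le_iff[OF \<open>\<alpha> > 0\<close> a[OF j]] H_bound[OF j]] by simp
    show "(\<lambda>\<omega>. norm (H j (\<eta> \<omega>)) powr min 1 \<alpha>) \<in> borel_measurable M"
      using H[OF j] by measurable
  qed (use a in auto)
  then show "epowr (Lnorm M \<alpha> (\<lambda>\<omega>. R y (\<eta> \<omega>) - R y' (\<eta> \<omega>))) (min 1 \<alpha>)
      \<le> ennreal (\<Sum>j=1..p. a j * norm (y j - y' j) powr min 1 \<alpha>)"
    using a by (subst epowr_Lnorm_le_iff[OF \<open>\<alpha> > 0\<close>]) (auto simp: mult.commute intro!: sum_nonneg)
qed

text \<open>The whole path of \<open>causal G \<epsilon>\<close> is one measurable function F of the
  innovation path, and F commutes with time shifts; so the shift invariance of the law of the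
  innovations passes to the solution.\<close>

lemma stationary_causal:
  fixes G :: "(nat \<Rightarrow> 'e) \<Rightarrow> 'b::topological_space"
  assumes \<epsilon>: "(\<lambda>\<omega> i. \<epsilon> i \<omega>) \<in> measurable M (\<Pi>\<^sub>M i\<in>UNIV. S)"
    and law: "\<And>k. distr M (\<Pi>\<^sub>M i\<in>UNIV. S) (\<lambda>\<omega> i. \<epsilon> (i + k) \<omega>) =
      distr M (\<Pi>\<^sub>M i\<in>UNIV. S) (\<lambda>\<omega> i. \<epsilon> i \<omega>)"
    and G: "G \<in> borel_measurable (\<Pi>\<^sub>M k\<in>UNIV. S)"
  shows "stationary M (causal G \<epsilon>)"
proof -
  have past: "(\<lambda>e. past e n) \<in> measurable (\<Pi>\<^sub>M i\<in>UNIV. S) (\<Pi>\<^sub>M k\<in>UNIV. S)" for n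
    unfolding past_def by (rule measurable_PiM_single') (auto simp: space_PiM)
  define F where "F e n = G (past e n)" for e n
  have F: "F \<in> measurable (\<Pi>\<^sub>M i\<in>UNIV. S) (\<Pi>\<^sub>M n\<in>UNIV. borel)"
    unfolding F_def by (rule measurable_PiM_single') (auto intro: measurable_compose[OF past G])
  have "(\<lambda>e i. e (i + k)) \<in> measurable (\<Pi>\<^sub>M i\<in>UNIV. S) (\<Pi>\<^sub>M i\<in>UNIV. S)" for k :: int
    by (rule measurable_PiM_single') (auto simp: space_PiM)
  from measurable_compose[OF \<epsilon> this]
  have meas: "(\<lambda>\<omega> i. \<epsilon> (i + k) \<omega>) \<in> measurable M (\<Pi>\<^sub>M i\<in>UNIV. S)" for k
    by simp
  have shift: "(\<lambda>\<omega> n. causal G \<epsilon> (n + k) \<omega>) = (\<lambda>\<omega>. F (\<lambda>i. \<epsilon> (i + k) \<omega>))" for k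
    by (simp add: fun_eq_iff causal_def F_def past_def algebra_simps)
  have "distr M (\<Pi>\<^sub>M n\<in>UNIV. borel) (\<lambda>\<omega> n. causal G \<epsilon> (n + k) \<omega>)
      = distr (distr M (\<Pi>\<^sub>M i\<in>UNIV. S) (\<lambda>\<omega> i. \<epsilon> i \<omega>)) (\<Pi>\<^sub>M n\<in>UNIV. borel) F" for k
    unfolding shift law[of k, symmetric] using meas[of k] F by (simp add: distr_distr comp_def)
  from this this[of 0]
  have "distr M (\<Pi>\<^sub>M n\<in>UNIV. borel) (\<lambda>\<omega> n. causal G \<epsilon> (n + k) \<omega>)
      = distr M (\<Pi>\<^sub>M n\<in>UNIV. borel) (\<lambda>\<omega> n. causal G \<epsilon> n \<omega>)" for k
    by simp
  moreover have "causal G \<epsilon> n \<in> borel_measurable M" for n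
    using measurable_compose[OF measurable_compose[OF \<epsilon> past] G]
    by (simp add: causal_def[abs_def])
  ultimately show ?thesis
    by (simp add: stationary_def)
qed

text \<open>\<open>case_option \<eta> \<epsilon>\<close> joins the generic innovation \<eta>, placed
  at \<open>None\<close>, to the two-sided sequence, so that a single i.i.d. hypothesis covers
  both.\<close>

theorem theorem5p1:
  fixes M :: "'w measure"
    and S :: "'e measure"
    and \<eta> :: "'w \<Rightarrow> 'e"
    and \<epsilon> :: "int \<Rightarrow> 'w \<Rightarrow> 'e"
    and p :: nat
    and R :: "(nat \<Rightarrow> real ^ 'd) \<Rightarrow> 'e \<Rightarrow> real ^ 'd"
    and \<alpha> :: real
  assumes "prob_space M"
    and "iid M S (case_option \<eta> \<epsilon>) UNIV"
    and "p \<ge> 1"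
    and "case_prod R \<in> borel_measurable (states p \<Otimes>\<^sub>M S)"
    and "\<alpha> > 0"
  shows
    "(\<forall>y\<^sub>0 a.
        y\<^sub>0 \<in> space (states p) \<and> in_L M \<alpha> (\<lambda>\<omega>. R y\<^sub>0 (\<eta> \<omega>)) \<and>
        (\<forall>j\<in>{1..p}. a j \<ge> 0) \<and> (\<Sum>j=1..p. a j) < 1 \<and> contraction M p R \<eta> \<alpha> a \<longrightarrow>
        (\<exists>G \<in> borel_measurable (\<Pi>\<^sub>M k\<in>UNIV. S).
           stationary M (causal G \<epsilon>) \<and> solves_recursion M p R \<epsilon> (causal G \<epsilon>) \<and>
           GMC M G \<epsilon> \<alpha>)) \<and>
     (\<forall>H :: nat \<Rightarrow> 'e \<Rightarrow> real.
        (\<forall>j\<in>{1..p}. H j \<in> borel_measurable S) \<and>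
        (\<forall>y\<in>space (states p). \<forall>y'\<in>space (states p). AE \<omega> in M.
           norm (R y (\<eta> \<omega>) - R y' (\<eta> \<omega>)) \<le> (\<Sum>j=1..p. H j (\<eta> \<omega>) * norm (y j - y' j))) \<and>
        (\<Sum>j=1..p. epowr (Lnorm M \<alpha> (\<lambda>\<omega>. H j (\<eta> \<omega>))) (min 1 \<alpha>)) < 1 \<longrightarrow>
        (let a = (\<lambda>j. enn2real (epowr (Lnorm M \<alpha> (\<lambda>\<omega>. H j (\<eta> \<omega>))) (min 1 \<alpha>)))
         in (\<forall>j\<in>{1..p}. a j \<ge> 0) \<and> (\<Sum>j=1..p. a j) < 1 \<and> contraction M p R \<eta> \<alpha> a))"
proof (rule conjI; intro allI impI; (elim conjE)?)
  interpret prob_space M by fact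
  note iid = assms(2)
  have "indep_vars (\<lambda>_. S) (case_option \<eta> \<epsilon>) UNIV"
    using iid by (simp add: iid_def)
  then have "\<forall>i. case_option \<eta> \<epsilon> i \<in> measurable M S"
    by (auto simp: indep_vars_def)
  from spec[OF this, of None] have \<eta> [measurable]: "\<eta> \<in> measurable M S"
    by simp
  {
    fix y\<^sub>0 a
    assume y\<^sub>0: "y\<^sub>0 \<in> space (states p)" and start: "in_L M \<alpha> (\<lambda>\<omega>. R y\<^sub>0 (\<eta> \<omega>))"
      and a: "\<forall>j\<in>{1..p}. a j \<ge> 0" "(\<Sum>j=1..p. a j) < 1"
      and contr: "contraction M p R \<eta> \<alpha> a"
    \<comment> \<open>The common law of all innovations; hypotheses stated through \<eta> become
      statements about \<open>Q\<close>.\<close>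
    define Q where "Q = distr M S \<eta>"
    have sets_Q [measurable_cong]: "sets Q = sets S"
      by (simp add: Q_def)
    interpret Q: prob_space Q
      unfolding Q_def by (rule prob_space_distr) fact
    have R_Q: "case_prod R \<in> borel_measurable (states p \<Otimes>\<^sub>M Q)"
      using assms(4) by (simp cong: measurable_cong_sets sets_pair_measure_cong add: sets_Q)
    have R_y [measurable]: "R y \<in> borel_measurable S" if "y \<in> space (states p)" for y
      using measurable_compose[OF measurable_Pair1'[OF that] assms(4)] by simp
    obtain K where K: "epowr (Lnorm M \<alpha> (\<lambda>\<omega>. R y\<^sub>0 (\<eta> \<omega>))) (min 1 \<alpha>) = ennreal K" "K \<ge> 0"
      using start epowr_less_infinity[of "Lnorm M \<alpha> (\<lambda>\<omega>. R y\<^sub>0 (\<eta> \<omega>))" "min 1 \<alpha>"]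
      by (cases "epowr (Lnorm M \<alpha> (\<lambda>\<omega>. R y\<^sub>0 (\<eta> \<omega>))) (min 1 \<alpha>)") (auto simp: in_L_def)
    interpret contractive_recursion Q p R \<alpha> a y\<^sub>0
    proof
      fix y y' :: "nat \<Rightarrow> real ^ 'd"
      assume y: "y \<in> space (states p)" "y' \<in> space (states p)"
      have "moment_bound M (max 1 \<alpha>) (\<lambda>\<omega>. norm (R y (\<eta> \<omega>) - R y' (\<eta> \<omega>)) powr min 1 \<alpha>)
          (\<Sum>j=1..p. a j * norm (y j - y' j) powr min 1 \<alpha>)"
        using contr y a unfolding contraction_def
        by (subst epowr_Lnorm_le_iff[OF \<open>\<alpha> > 0\<close>, symmetric]) (auto intro!: sum_nonneg)
      then show "moment_bound Q (max 1 \<alpha>) (\<lambda>e. norm (R y e - R y' e) powr min 1 \<alpha>)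
          (\<Sum>j=1..p. a j * norm (y j - y' j) powr min 1 \<alpha>)"
        unfolding Q_def using y by (subst moment_bound_distr) auto
    next
      have "moment_bound M (max 1 \<alpha>) (\<lambda>\<omega>. norm (R y\<^sub>0 (\<eta> \<omega>)) powr min 1 \<alpha>) K"
        using K by (subst epowr_Lnorm_le_iff[OF \<open>\<alpha> > 0\<close>, symmetric]) auto
      then have "moment_bound Q (max 1 \<alpha>) (\<lambda>e. norm (R y\<^sub>0 e) powr min 1 \<alpha>) K"
        unfolding Q_def using y\<^sub>0 by (subst moment_bound_distr) auto
      with K show "\<exists>K\<ge>0. moment_bound Q (max 1 \<alpha>) (\<lambda>e. norm (R y\<^sub>0 e) powr min 1 \<alpha>) K"
        by blast
    qed (use assms y\<^sub>0 a R_Q in auto)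
    define P where "P = (\<Pi>\<^sub>M k\<in>(UNIV :: nat set). Q)"
    have sets_P: "sets P = sets (\<Pi>\<^sub>M k\<in>UNIV. S)"
      unfolding P_def by (intro sets_PiM_cong) (simp_all add: sets_Q)
    have G_meas: "G \<in> borel_measurable (\<Pi>\<^sub>M k\<in>UNIV. S)"
      using measurable_G measurable_cong_sets[OF sets_P refl] unfolding P_def by blast
    \<comment> \<open>The past at any time n has the law of the canonical sequence, which is what
      carries the results of the locale back to \<open>M\<close>.\<close>
    have past_meas: "(\<lambda>\<omega>. past (\<lambda>i. \<epsilon> i \<omega>) n) \<in> measurable M P"
      and past_law: "distr M P (\<lambda>\<omega>. past (\<lambda>i. \<epsilon> i \<omega>) n) = P" for n
    proof -
      have inj: "inj (\<lambda>k. Some (n - int k))"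
        by (auto simp: inj_def)
      show "(\<lambda>\<omega>. past (\<lambda>i. \<epsilon> i \<omega>) n) \<in> measurable M P"
        using distr_iid_reindex(1)[OF assms(1) iid inj]
        by (simp add: past_def measurable_cong_sets[OF refl sets_P])
      have "distr M P (\<lambda>\<omega>. past (\<lambda>i. \<epsilon> i \<omega>) n)
          = distr M (\<Pi>\<^sub>M k\<in>UNIV. S) (\<lambda>\<omega>. past (\<lambda>i. \<epsilon> i \<omega>) n)"
        by (rule distr_cong[OF refl sets_P refl])
      also have "\<dots> = P"
        using distr_iid_reindex(2)[OF assms(1) iid inj, of None]
        by (simp add: past_def P_def Q_def)
      finally show "distr M P (\<lambda>\<omega>. past (\<lambda>i. \<epsilon> i \<omega>) n) = P" .
    qed
    have "stationary M (causal G \<epsilon>)"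
    proof (rule stationary_causal[OF _ _ G_meas])
      have inj: "inj (\<lambda>i. Some (i + k))" for k :: int
        by (auto simp: inj_def)
      show "(\<lambda>\<omega> i. \<epsilon> i \<omega>) \<in> measurable M (\<Pi>\<^sub>M i\<in>UNIV. S)"
        using distr_iid_reindex(1)[OF assms(1) iid inj[of 0]] by simp
      show "distr M (\<Pi>\<^sub>M i\<in>UNIV. S) (\<lambda>\<omega> i. \<epsilon> (i + k) \<omega>) =
          distr M (\<Pi>\<^sub>M i\<in>UNIV. S) (\<lambda>\<omega> i. \<epsilon> i \<omega>)" for k
        using distr_iid_reindex(2)[OF assms(1) iid inj[of k], of None]
          distr_iid_reindex(2)[OF assms(1) iid inj[of 0], of None] by simp
    qed
    moreover have "solves_recursion M p R \<epsilon> (causal G \<epsilon>)"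
      unfolding solves_recursion_def AE_all_countable
    proof
      fix n
      \<comment> \<open>Apply the canonical recursion to the past at time n + 1, whose entry 0 is
        the innovation of that time. Countably many times leave only a null set of
        exceptions.\<close>
      have "AE s in distr M P (\<lambda>\<omega>. past (\<lambda>i. \<epsilon> i \<omega>) (n + 1)). G s = R (\<lambda>j\<in>{1..p}. G (\<lambda>k. s (k + j))) (s 0)"
        using AE_G_recursion by (simp only: past_law) (simp only: P_def)
      from AE_distrD[OF past_meas this]
      show "AE \<omega> in M. causal G \<epsilon> (n + 1) \<omega> = R (lags p (\<lambda>i. causal G \<epsilon> i \<omega>) n) (\<epsilon> (n + 1) \<omega>)"
        by (simp add: causal_def lags_def past_def algebra_simps cong: restrict_cong)
    qed
    moreover have "GMC M G \<epsilon> \<alpha>"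
    proof -
      obtain C r where C: "0 < C" "0 < r" "r < 1"
        and bd: "\<And>n. (\<integral>\<^sup>+x. ennreal (norm (G (comb_seq n (fst x) (snd x)) - G (fst x)) powr \<alpha>) \<partial>(P \<Otimes>\<^sub>M P))
          \<le> ennreal (C * r ^ n)"
        using G_coupling_bound unfolding P_def by blast
      have "(\<integral>\<^sup>+w. ennreal (norm (G (past (\<lambda>i. if i \<le> 0 then \<epsilon> i (snd w) else \<epsilon> i (fst w)) (int n))
          - causal G \<epsilon> (int n) (fst w)) powr \<alpha>) \<partial>(M \<Otimes>\<^sub>M M)) \<le> ennreal (C * r ^ n)" for n
      proof -
        \<comment> \<open>On \<open>M \<Otimes>\<^sub>M M\<close> the past of \<epsilon> at time n
          and the past of the copy at time 0 are independent with law \<open>P\<close>, and the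
          coupled past is \<open>comb_seq n\<close> of the two. The moment is thus an integral over
          \<open>P \<Otimes>\<^sub>M P\<close>.\<close>
        define h where "h = (\<lambda>x. ennreal (norm (G (comb_seq n (fst x) (snd x)) - G (fst x)) powr \<alpha>))"
        have h: "h \<in> borel_measurable (P \<Otimes>\<^sub>M P)"
          unfolding h_def P_def by measurable
        have "P \<Otimes>\<^sub>M P = distr M P (\<lambda>\<omega>. past (\<lambda>i. \<epsilon> i \<omega>) (int n)) \<Otimes>\<^sub>M distr M P (\<lambda>\<omega>. past (\<lambda>i. \<epsilon> i \<omega>) 0)"
          by (simp only: past_law)
        also have "\<dots> = distr (M \<Otimes>\<^sub>M M) (P \<Otimes>\<^sub>M P)
            (\<lambda>(\<omega>, \<omega>'). (past (\<lambda>i. \<epsilon> i \<omega>) (int n), past (\<lambda>i. \<epsilon> i \<omega>') 0))"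
          using P.sigma_finite_measure_axioms unfolding P_def[symmetric]
          by (intro pair_measure_distr past_meas) (simp only: past_law)
        finally have PP: "P \<Otimes>\<^sub>M P = \<dots>" .
        have "(\<integral>\<^sup>+x. h x \<partial>(P \<Otimes>\<^sub>M P))
            = (\<integral>\<^sup>+w. h (past (\<lambda>i. \<epsilon> i (fst w)) (int n), past (\<lambda>i. \<epsilon> i (snd w)) 0) \<partial>(M \<Otimes>\<^sub>M M))"
          using h past_meas by (subst PP, subst nn_integral_distr) (auto simp: split_beta')
        also have "\<dots> = (\<integral>\<^sup>+w. ennreal (norm (G (past (\<lambda>i. if i \<le> 0 then \<epsilon> i (snd w) else \<epsilon> i (fst w)) (int n))
          - causal G \<epsilon> (int n) (fst w)) powr \<alpha>) \<partial>(M \<Otimes>\<^sub>M M))"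
          by (simp add: h_def past_mixed_eq_comb_seq causal_def)
        finally show ?thesis
          using bd[of n] by (simp add: h_def)
      qed
      with C show ?thesis
        unfolding GMC_def Let_def split_beta' by blast
    qed
    ultimately show "\<exists>G \<in> borel_measurable (\<Pi>\<^sub>M k\<in>UNIV. S).
        stationary M (causal G \<epsilon>) \<and> solves_recursion M p R \<epsilon> (causal G \<epsilon>) \<and> GMC M G \<epsilon> \<alpha>"
      using G_meas by blast
  next
    fix H :: "nat \<Rightarrow> 'e \<Rightarrow> real"
    assume H: "\<forall>j\<in>{1..p}. H j \<in> borel_measurable S"
      and Lip: "\<forall>y\<in>space (states p). \<forall>y'\<in>space (states p). AE \<omega> in M.
           norm (R y (\<eta> \<omega>) - R y' (\<eta> \<omega>)) \<le> (\<Sum>j=1..p. H j (\<eta> \<omega>) * norm (y j - y' j))"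
      and sum: "(\<Sum>j=1..p. epowr (Lnorm M \<alpha> (\<lambda>\<omega>. H j (\<eta> \<omega>))) (min 1 \<alpha>)) < 1"
    define b where "b j = epowr (Lnorm M \<alpha> (\<lambda>\<omega>. H j (\<eta> \<omega>))) (min 1 \<alpha>)" for j
    \<comment> \<open>Each coefficient is finite, being at most a sum below 1. This is essential
      since \<open>enn2real\<close> sends infinity to 0.\<close>
    have b: "b j = ennreal (enn2real (b j))" if "j \<in> {1..p}" for j
    proof -
      have "b j \<le> (\<Sum>j=1..p. b j)"
        using that by (intro member_le_sum) auto
      also have "\<dots> < 1"
        using sum by (simp add: b_def)
      finally have "b j < top"
        by (rule less_trans) simp
      then show ?thesis
        by (simp only: ennreal_enn2real)
    qed
    have "ennreal (\<Sum>j=1..p. enn2real (b j)) = (\<Sum>j=1..p. b j)"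
      using b by (simp flip: sum_ennreal)
    also have "\<dots> < ennreal 1"
      using sum by (simp add: b_def)
    finally have "(\<Sum>j=1..p. enn2real (b j)) < 1"
      by (simp add: ennreal_less_iff sum_nonneg)
    moreover have "contraction M p R \<eta> \<alpha> (\<lambda>j. enn2real (b j))"
    proof (rule contraction_of_Lipschitz[OF \<open>\<alpha> > 0\<close> \<eta>])
      fix j assume "j \<in> {1..p}"
      from b[OF this]
      show "epowr (Lnorm M \<alpha> (\<lambda>\<omega>. H j (\<eta> \<omega>))) (min 1 \<alpha>) \<le> ennreal (enn2real (b j))"
        by (simp add: b_def)
    qed (use H Lip in auto)
    ultimately show "let a = (\<lambda>j. enn2real (epowr (Lnorm M \<alpha> (\<lambda>\<omega>. H j (\<eta> \<omega>))) (min 1 \<alpha>)))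
         in (\<forall>j\<in>{1..p}. a j \<ge> 0) \<and> (\<Sum>j=1..p. a j) < 1 \<and> contraction M p R \<eta> \<alpha> a"
      by (simp add: Let_def b_def)
  }
qed

end
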